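(* Let $k$ be a field with a valuation $\nu : k \to \mathbf{R}\cup\{\infty\}$, let $S = k[x,y,z]$ with its standard grading, and let $\mathbf{T}=(\mathbf{R}\cup\{\infty\},\min,+)$. Then there exist a homogeneous tropical ideal $J \subseteq \mathbf{T}[x,y,z]$ and a family $(J_\lambda)$ of homogeneous ideals of $S$, indexed by the elements $\lambda \in k$ with $\nu(\lambda)=0$, such that: (1) the ideals $J_\lambda$ are pairwise distinct, i.e. $J_\lambda \neq J_\mu$ whenever $\lambda\neq\mu$; (2) each $J_\lambda$ is saturated; (3) each $J_\lambda$ is a realisation of $J$, i.e. $\mathrm{trop}(J_\lambda)=J$; (4) for every $\lambda\in k$ with $\nu(\lambda)=0$ and $\lambda\neq 1$, the graded Betti numbers of $S/J_1$ differ from those of $S/J_\lambda$, i.e. there exist $i,j$ with $\beta_{i,j}(S/J_1)\neq\beta_{i,j}(S/J_\lambda)$.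
   Context: $\mathbf{T}$ is the tropical semiring, with addition $\min$ and multiplication $+$; $\mathbf{T}[x,y,z]$ is the semiring of polynomials with coefficients in $\mathbf{T}$ (a monomial with coefficient $\infty$ is absent). For $f=\sum_u c_u \mathbf{x}^u\in S$, its tropicalisation is $\mathrm{trop}(f)=\sum_u \nu(c_u)\mathbf{x}^u\in\mathbf{T}[x,y,z]$ (tropical polynomial). For an ideal $I\subseteq S$, $\mathrm{trop}(I)$ is the ideal of $\mathbf{T}[x,y,z]$ generated by $\{\mathrm{trop}(f): f\in I\}$. A homogeneous ideal $J\subseteq \mathbf{T}[x,y,z]$ is a (homogeneous) tropical ideal if each graded piece $J_d$ is a tropical linear space; equivalently, for every $d\geq 0$, all $f,g\in J_d$ and every monomial $\mathbf{x}^u$ of degree $d$ whose coefficients in $f$ and $g$ satisfy $[f]_u=[g]_u\neq\infty$, there is $h\in J_d$ with $[h]_u=\infty$ and $[h]_v\geq \min([f]_v,[g]_v)$ for all $v$, with equality whenever $[f]_v\neq[g]_v$. Here $[f]_v$ denotes the coefficient of $\mathbf{x}^v$ in $f$. An ideal $I\subseteq S$ realises $J$ (is a realisation of $J$) if $\mathrm{trop}(I)=J$. A homogeneous ideal $I\subseteq S$ is saturated if $(I:(x,y,z)^\infty)=I$. The graded Betti numbers of a finitely generated graded $S$-module $M$ are $\beta_{i,j}(M)=\dim_k \mathrm{Tor}_i^S(M,k)_j$, i.e. the number of degree-$j$ generators of the $i$-th free module in the minimal graded free resolution of $M$. *)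

theory Defs
  imports
    "HOL-Library.Poly_Mapping"
    "Jordan_Normal_Form.Matrix_Kernel"
begin

section \<open>The tropical semiring\<close>

datatype tropical = Fin real | Infty

instantiation tropical :: linorder
begin

fun less_eq_tropical :: "tropical \<Rightarrow> tropical \<Rightarrow> bool" where
  "Fin a \<le> Fin b \<longleftrightarrow> a \<le> b"
| "a \<le> Infty \<longleftrightarrow> True"
| "Infty \<le> Fin b \<longleftrightarrow> False"

definition less_tropical :: "tropical \<Rightarrow> tropical \<Rightarrow> bool" where
  "a < b \<longleftrightarrow> a \<le> b \<and> \<not> b \<le> (a::tropical)"

instance
proof
  fix x y z :: tropical
  show "x < y \<longleftrightarrow> x \<le> y \<and> \<not> y \<le> x" by (rule less_tropical_def)
  show "x \<le> x" by (cases x) auto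
  show "x \<le> y \<Longrightarrow> y \<le> z \<Longrightarrow> x \<le> z" by (cases x; cases y; cases z) auto
  show "x \<le> y \<Longrightarrow> y \<le> x \<Longrightarrow> x = y" by (cases x; cases y) auto
  show "x \<le> y \<or> y \<le> x" by (cases x; cases y) auto
qed

end

text \<open>
  The class operations are the tropical ones: \<open>+\<close> is the minimum, \<open>*\<close> is the addition of
  real numbers, \<open>0\<close> is infinity and \<open>1\<close> is the real number zero.
\<close>

instantiation tropical :: comm_semiring_1
begin

definition zero_tropical :: tropical where "0 = Infty"

definition one_tropical :: tropical where "1 = Fin 0"

definition plus_tropical :: "tropical \<Rightarrow> tropical \<Rightarrow> tropical" where
  "a + b = min a (b::tropical)"

fun times_tropical :: "tropical \<Rightarrow> tropical \<Rightarrow> tropical" where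
  "Fin a * Fin b = Fin (a + b)"
| "a * Infty = Infty"
| "Infty * b = Infty"

instance
proof
  fix a b c :: tropical
  show "a * b * c = a * (b * c)" by (cases a; cases b; cases c) auto
  show "a * b = b * a" by (cases a; cases b) auto
  show "1 * a = a" by (cases a) (auto simp: one_tropical_def)
  show "a + b + c = a + (b + c)" by (auto simp: plus_tropical_def min.assoc)
  show "a + b = b + a" by (auto simp: plus_tropical_def min.commute)
  show "0 + a = a" by (cases a) (auto simp: plus_tropical_def zero_tropical_def min_def)
  show "0 * a = 0" by (cases a) (auto simp: zero_tropical_def)
  show "a * 0 = 0" by (cases a) (auto simp: zero_tropical_def)
  show "(a + b) * c = a * c + b * c"
    by (cases a; cases b; cases c) (auto simp: plus_tropical_def min_def)
  show "(0::tropical) \<noteq> 1" by (auto simp: zero_tropical_def one_tropical_def)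
qed

end

text \<open>
  The multiplicativity clause reads \<open>\<nu>(ab) = \<nu>(a) + \<nu>(b)\<close> in classical notation, since the
  product on the right is that of the tropical semiring.
\<close>

definition valuation :: "('k::field \<Rightarrow> tropical) \<Rightarrow> bool" where
  "valuation \<nu> \<longleftrightarrow>
     (\<forall>a. \<nu> a = Infty \<longleftrightarrow> a = 0) \<and>
     (\<forall>a b. \<nu> (a * b) = \<nu> a * \<nu> b) \<and>
     (\<forall>a b. min (\<nu> a) (\<nu> b) \<le> \<nu> (a + b))"


section \<open>Polynomials in three variables and their ideals\<close>

datatype var = X | Y | Z

type_synonym monomial = "var \<Rightarrow>\<^sub>0 nat"

type_synonym 'a poly3 = "monomial \<Rightarrow>\<^sub>0 'a"

abbreviation coef :: "'a::zero poly3 \<Rightarrow> monomial \<Rightarrow> 'a" where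
  "coef \<equiv> Poly_Mapping.lookup"

definition variable :: "var \<Rightarrow> 'a::zero_neq_one poly3" where
  "variable i = Poly_Mapping.single (Poly_Mapping.single i 1) 1"

definition mdeg :: "monomial \<Rightarrow> nat" where
  "mdeg u = Poly_Mapping.lookup u X + Poly_Mapping.lookup u Y + Poly_Mapping.lookup u Z"

text \<open>The zero polynomial is homogeneous of every degree.\<close>

definition homogeneous :: "nat \<Rightarrow> 'a::zero poly3 \<Rightarrow> bool" where
  "homogeneous d f \<longleftrightarrow> (\<forall>u\<in>Poly_Mapping.keys f. mdeg u = d)"

text \<open>
  The library notions of an ideal require a ring; this one also covers semirings of
  tropical polynomials.
\<close>

definition is_ideal :: "'a::comm_semiring_1 set \<Rightarrow> bool" where
  "is_ideal I \<longleftrightarrow>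
     0 \<in> I \<and> (\<forall>f\<in>I. \<forall>g\<in>I. f + g \<in> I) \<and> (\<forall>f\<in>I. \<forall>r. r * f \<in> I)"

abbreviation ideal_gen :: "'a::comm_semiring_1 set \<Rightarrow> 'a set" where
  "ideal_gen G \<equiv> is_ideal hull G"

definition homogeneous_ideal :: "'a::comm_semiring_1 poly3 set \<Rightarrow> bool" where
  "homogeneous_ideal I \<longleftrightarrow> is_ideal I \<and> I = ideal_gen {f \<in> I. \<exists>d. homogeneous d f}"

definition graded_piece :: "'a::zero poly3 set \<Rightarrow> nat \<Rightarrow> 'a poly3 set" where
  "graded_piece I d = {f \<in> I. homogeneous d f}"

definition ideal_quotient :: "'a::comm_semiring_1 set \<Rightarrow> 'a set \<Rightarrow> 'a set" where
  "ideal_quotient I K = {f. \<forall>g\<in>K. f * g \<in> I}"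

fun ideal_power :: "'a::comm_semiring_1 set \<Rightarrow> nat \<Rightarrow> 'a set" where
  "ideal_power K 0 = UNIV"
| "ideal_power K (Suc n) = ideal_gen {a * b |a b. a \<in> K \<and> b \<in> ideal_power K n}"

definition saturation :: "'a::comm_semiring_1 set \<Rightarrow> 'a set \<Rightarrow> 'a set" where
  "saturation I K = (\<Union>n. ideal_quotient I (ideal_power K n))"

definition irrelevant_ideal :: "'a::comm_semiring_1 poly3 set" where
  "irrelevant_ideal = ideal_gen {variable X, variable Y, variable Z}"

definition saturated :: "'a::comm_semiring_1 poly3 set \<Rightarrow> bool" where
  "saturated I \<longleftrightarrow> saturation I irrelevant_ideal = I"


section \<open>Tropicalisation and tropical ideals\<close>

definition trop_poly :: "('k::field \<Rightarrow> tropical) \<Rightarrow> 'k poly3 \<Rightarrow> tropical poly3" where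
  "trop_poly \<nu> f = Poly_Mapping.map \<nu> f"

definition trop_ideal :: "('k::field \<Rightarrow> tropical) \<Rightarrow> 'k poly3 set \<Rightarrow> tropical poly3 set" where
  "trop_ideal \<nu> I = ideal_gen (trop_poly \<nu> ` I)"

definition realises :: "('k::field \<Rightarrow> tropical) \<Rightarrow> 'k poly3 set \<Rightarrow> tropical poly3 set \<Rightarrow> bool" where
  "realises \<nu> I J \<longleftrightarrow> trop_ideal \<nu> I = J"

definition homogeneous_tropical_ideal :: "tropical poly3 set \<Rightarrow> bool" where
  "homogeneous_tropical_ideal J \<longleftrightarrow> homogeneous_ideal J \<and>
     (\<forall>d. \<forall>f\<in>graded_piece J d. \<forall>g\<in>graded_piece J d. \<forall>u.
        mdeg u = d \<longrightarrow> coef f u = coef g u \<longrightarrow> coef f u \<noteq> Infty \<longrightarrow>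
        (\<exists>h\<in>graded_piece J d. coef h u = Infty \<and>
           (\<forall>v. min (coef f v) (coef g v) \<le> coef h v \<and>
                (coef f v \<noteq> coef g v \<longrightarrow> coef h v = min (coef f v) (coef g v)))))"


section \<open>Minimal graded free resolutions and graded Betti numbers\<close>

text \<open>
  The graded free module with a basis of degrees \<open>ds\<close> is the direct sum of the \<open>S(-d)\<close> for
  \<open>d\<close> in the list \<open>ds\<close>; its elements are the vectors in \<open>carrier_vec (length ds)\<close>.
  A matrix represents a degree-preserving map from the module with basis degrees \<open>src\<close> to the one with
  basis degrees \<open>tgt\<close> iff its entry at \<open>(a, b)\<close> is homogeneous of degree \<open>src ! b - tgt ! a\<close>
  (hence zero if this number is negative).
\<close>

definition graded_map :: "int list \<Rightarrow> int list \<Rightarrow> 'k::field poly3 mat \<Rightarrow> bool" where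
  "graded_map tgt src A \<longleftrightarrow>
     A \<in> carrier_mat (length tgt) (length src) \<and>
     (\<forall>a<length tgt. \<forall>b<length src. \<forall>u\<in>Poly_Mapping.keys (A $$ (a, b)).
        tgt ! a + int (mdeg u) = src ! b)"

definition mat_image :: "'a::comm_ring_1 mat \<Rightarrow> 'a vec set" where
  "mat_image A = {A *\<^sub>v w |w. w \<in> carrier_vec (dim_col A)}"

text \<open>
  \<open>degs i\<close> are the degrees of the basis of the \<open>i\<close>-th free module \<open>F i\<close> and \<open>D i\<close> is the
  differential from \<open>F (i + 1)\<close> to \<open>F i\<close>. The augmentation from \<open>F 0\<close> to \<open>S/I\<close> is given by
  homogeneous representatives \<open>e $ a\<close> in \<open>S\<close> of the images of the basis vectors; the two clauses
  about \<open>e\<close> after the grading condition say that it is surjective and has kernel \<open>mat_image (D 0)\<close>.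
\<close>

definition graded_free_resolution ::
  "'k::field poly3 set \<Rightarrow> (nat \<Rightarrow> int list) \<Rightarrow> 'k poly3 vec \<Rightarrow> (nat \<Rightarrow> 'k poly3 mat) \<Rightarrow> bool" where
  "graded_free_resolution I degs e D \<longleftrightarrow>
     e \<in> carrier_vec (length (degs 0)) \<and>
     (\<forall>a<length (degs 0). \<forall>u\<in>Poly_Mapping.keys (e $ a). int (mdeg u) = degs 0 ! a) \<and>
     (\<forall>f. \<exists>v\<in>carrier_vec (length (degs 0)). f - e \<bullet> v \<in> I) \<and>
     {v \<in> carrier_vec (length (degs 0)). e \<bullet> v \<in> I} = mat_image (D 0) \<and>
     (\<forall>i. graded_map (degs i) (degs (Suc i)) (D i)) \<and>
     (\<forall>i. mat_kernel (D i) = mat_image (D (Suc i)))"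

definition minimal_graded_free_resolution ::
  "'k::field poly3 set \<Rightarrow> (nat \<Rightarrow> int list) \<Rightarrow> 'k poly3 vec \<Rightarrow> (nat \<Rightarrow> 'k poly3 mat) \<Rightarrow> bool" where
  "minimal_graded_free_resolution I degs e D \<longleftrightarrow>
     graded_free_resolution I degs e D \<and>
     (\<forall>i. \<forall>a<length (degs i). \<forall>b<length (degs (Suc i)). D i $$ (a, b) \<in> irrelevant_ideal)"

text \<open>
  \<open>betti I i j\<close> is the graded Betti number of the module \<open>S/I\<close>, for a homogeneous ideal \<open>I\<close>;
  the description is proper because minimal graded free resolutions exist and are unique up to
  isomorphism.
\<close>

definition betti :: "'k::field poly3 set \<Rightarrow> nat \<Rightarrow> int \<Rightarrow> nat" where
  "betti I i j =
     (THE n. \<exists>degs e D. minimal_graded_free_resolution I degs e D \<and> n = count_list (degs i) j)"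

end

theory Submission
  imports Defs
begin

text \<open>
  A quadratic form \<open>p x\<^sup>2 + q x y + r y\<^sup>2\<close> is subjected to the single linear condition
  \<open>p + q + l r = 0\<close>, and \<open>I\<^sub>l\<close> is the ideal of \<open>k[x,y,z]\<close> generated by the forms that satisfy it together with
  \<open>(x,y)\<^sup>3\<close>. It is extended from \<open>k[x,y]\<close>, so \<open>z\<close> is a nonzerodivisor modulo \<open>I\<^sub>l\<close> and \<open>I\<^sub>l\<close> is
  saturated; and \<open>l\<close> can be recovered from the quadrics in \<open>I\<^sub>l\<close>.

  The tropicalisation forgets \<open>l\<close>. If \<open>\<nu>(l) = 0\<close>, the condition says that \<open>(p,q,r)\<close> lies in a plane whose three
  circuits have two nonzero coefficients each, all of valuation zero. The tropicalisation of this plane is therefore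
  the set \<open>trop_plane\<close> of triples whose minimum is attained at least twice, whatever \<open>l\<close> is,
  and everything of degree at least three in \<open>x, y\<close> is present for every \<open>l\<close>
  (\<open>trop_ideal_quad_plane\<close>). The same description gives the elimination axiom
  directly (\<open>tropical_ideal_elimination\<close>).

  The Betti numbers do see \<open>l\<close>. The functional \<open>(1, 1, l)\<close> is the evaluation of quadratic forms at a point of the
  projective line precisely when \<open>l = 1\<close>, the point being \<open>(1:1)\<close>. For \<open>l \<noteq> 1\<close> the two quadrics
  \<open>x (x - y)\<close> and \<open>y (l x - y)\<close> in \<open>I\<^sub>l\<close> are coprime; they generate \<open>I\<^sub>l\<close> and the resolution is the Koszul complex,
  with no cubic generator (\<open>betti_generic\<close>). For \<open>l = 1\<close> they share the factor \<open>x - y\<close>, a linear syzygy appears, and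
  a cubic generator \<open>y\<^sup>3\<close> is needed (\<open>betti_special\<close>). So \<open>\<beta>\<^sub>1\<^sub>,\<^sub>3\<close> is \<open>0\<close> in the first case and \<open>1\<close> in the second.

  A value of \<open>betti\<close> requires both a minimal resolution, which is written down explicitly, and the
  independence of the number from the resolution. For the latter it suffices to know that the first differential
  of a minimal resolution is a list of generators of the ideal all of whose relations have coefficients in
  the irrelevant ideal (\<open>minimal_resolution_generators\<close>). Such generators are linearly independent modulo
  the irrelevant multiples of the ideal (\<open>nakayama\<close>), which are easy to describe in degree three.
\<close>

section \<open>Monomials and coefficients\<close>

text \<open>
  A linear order on the variables induces one on the monomials, and this makes
  the polynomials over a field an integral domain.
\<close>

instantiation var :: linorder
begin

primrec var_index :: "var \<Rightarrow> nat" where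
  "var_index X = 0"
| "var_index Y = 1"
| "var_index Z = 2"

definition less_eq_var :: "var \<Rightarrow> var \<Rightarrow> bool" where
  "i \<le> j \<longleftrightarrow> var_index i \<le> var_index j"

definition less_var :: "var \<Rightarrow> var \<Rightarrow> bool" where
  "i < j \<longleftrightarrow> var_index i < var_index j"

instance
proof
  fix i j k :: var
  show "i < j \<longleftrightarrow> i \<le> j \<and> \<not> j \<le> i" by (auto simp: less_var_def less_eq_var_def)
  show "i \<le> i" by (simp add: less_eq_var_def)
  show "i \<le> j \<Longrightarrow> j \<le> k \<Longrightarrow> i \<le> k" by (simp add: less_eq_var_def)
  show "i \<le> j \<Longrightarrow> j \<le> i \<Longrightarrow> i = j" by (cases i; cases j) (auto simp: less_eq_var_def)
  show "i \<le> j \<or> j \<le> i" by (auto simp: less_eq_var_def)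
qed

end

definition mon :: "nat \<Rightarrow> nat \<Rightarrow> nat \<Rightarrow> monomial" where
  "mon a b c = Poly_Mapping.single X a + Poly_Mapping.single Y b + Poly_Mapping.single Z c"

lemma lookup_mon [simp]:
  "Poly_Mapping.lookup (mon a b c) X = a"
  "Poly_Mapping.lookup (mon a b c) Y = b"
  "Poly_Mapping.lookup (mon a b c) Z = c"
  by (simp_all add: mon_def lookup_add lookup_single)

lemma monomial_eq_iff:
  "u = v \<longleftrightarrow> Poly_Mapping.lookup u X = Poly_Mapping.lookup v X \<and>
     Poly_Mapping.lookup u Y = Poly_Mapping.lookup v Y \<and>
     Poly_Mapping.lookup u Z = Poly_Mapping.lookup v Z" for u v :: monomial
  by (metis (full_types) poly_mapping_eqI var.exhaust)

lemma mon_inject [simp]: "mon a b c = mon a' b' c' \<longleftrightarrow> a = a' \<and> b = b' \<and> c = c'"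
  by (simp add: monomial_eq_iff)

lemma mon_cases:
  obtains a b c where "u = mon a b c"
proof -
  have "u = mon (Poly_Mapping.lookup u X) (Poly_Mapping.lookup u Y) (Poly_Mapping.lookup u Z)"
    by (simp add: monomial_eq_iff)
  then show ?thesis using that by blast
qed

lemma mon_add [simp]: "mon a b c + mon a' b' c' = mon (a + a') (b + b') (c + c')"
  by (simp add: monomial_eq_iff lookup_add)

lemma mon_eq_0_iff [simp]: "mon a b c = 0 \<longleftrightarrow> a = 0 \<and> b = 0 \<and> c = 0"
  by (simp add: monomial_eq_iff)

lemma mon_0: "mon 0 0 0 = 0"
  by simp

lemma mdeg_mon [simp]: "mdeg (mon a b c) = a + b + c"
  by (simp add: mdeg_def)

lemma variable_conv_mon:
  "variable X = Poly_Mapping.single (mon 1 0 0) 1"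
  "variable Y = Poly_Mapping.single (mon 0 1 0) 1"
  "variable Z = Poly_Mapping.single (mon 0 0 1) 1"
  by (simp_all add: variable_def mon_def)

lemma poly_eq_sum_terms: "f = (\<Sum>u\<in>Poly_Mapping.keys f. Poly_Mapping.single u (coef f u))"
proof (rule poly_mapping_eqI)
  fix v
  have "(\<Sum>u\<in>Poly_Mapping.keys f. coef f u when u = v) = coef f v"
    by (cases "v \<in> Poly_Mapping.keys f")
      (simp_all add: when_def sum.delta in_keys_iff)
  then show "coef f v = coef (\<Sum>u\<in>Poly_Mapping.keys f. Poly_Mapping.single u (coef f u)) v"
    by (simp add: lookup_sum lookup_single)
qed

lemma poly_induct [case_names zero add monomial]:
  fixes f :: "'a::comm_monoid_add poly3"
  assumes "P 0" "\<And>f g. P f \<Longrightarrow> P g \<Longrightarrow> P (f + g)"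
    and "\<And>a b c r. P (Poly_Mapping.single (mon a b c) r)"
  shows "P f"
proof -
  have "P (\<Sum>u\<in>A. Poly_Mapping.single u (coef f u))" if "finite A" for A
    using that
  proof (induction A)
    case (insert u A)
    then show ?case by (cases u rule: mon_cases) (auto intro: assms)
  qed (simp add: assms)
  then show ?thesis by (subst poly_eq_sum_terms) simp
qed

lemma coef_term_mult:
  fixes f :: "'a::comm_semiring_1 poly3"
  shows "coef (Poly_Mapping.single (mon i j k) r * f) (mon a b c) =
    (if i \<le> a \<and> j \<le> b \<and> k \<le> c then r * coef f (mon (a - i) (b - j) (c - k)) else 0)"
proof (induction f rule: poly_induct)
  case zero
  then show ?case by simp
next
  case (add f g)
  then show ?case by (simp add: distrib_left lookup_add)
next
  case (monomial a' b' c' r')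
  then show ?case by (auto simp: mult_single lookup_single when_def)
qed

lemma coef_0_mult: "coef (f * g) 0 = coef f 0 * coef g 0" for f :: "'a::comm_semiring_1 poly3"
proof (induction f rule: poly_induct)
  case zero
  then show ?case by simp
next
  case (add f g)
  then show ?case by (simp add: distrib_right lookup_add)
next
  case (monomial a b c r)
  then show ?case by (auto simp: mon_0[symmetric] coef_term_mult lookup_single when_def simp del: mon_eq_0_iff)
qed

lemma coef_map: "coef (Poly_Mapping.map h f) u = h (coef f u)" if "h 0 = 0"
  by (simp add: Poly_Mapping.map.rep_eq when_def that)

section \<open>Ideals\<close>

lemma is_idealI_terms:
  fixes I :: "'a::comm_semiring_1 poly3 set"
  assumes "0 \<in> I" "\<And>f g. f \<in> I \<Longrightarrow> g \<in> I \<Longrightarrow> f + g \<in> I"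
    and "\<And>f a b c r. f \<in> I \<Longrightarrow> Poly_Mapping.single (mon a b c) r * f \<in> I"
  shows "is_ideal I"
proof -
  have "r * f \<in> I" if "f \<in> I" for f r
    by (induction r rule: poly_induct) (simp_all add: assms that distrib_right)
  then show ?thesis using assms by (simp add: is_ideal_def)
qed

lemma is_ideal_ideal_gen: "is_ideal (ideal_gen G)"
  by (rule hull_in) (auto simp: is_ideal_def)

lemma ideal_zero: "is_ideal I \<Longrightarrow> 0 \<in> I"
  and ideal_add: "is_ideal I \<Longrightarrow> f \<in> I \<Longrightarrow> g \<in> I \<Longrightarrow> f + g \<in> I"
  and ideal_mult: "is_ideal I \<Longrightarrow> f \<in> I \<Longrightarrow> r * f \<in> I"
  by (simp_all add: is_ideal_def)

lemma ideal_diff: "is_ideal I \<Longrightarrow> f \<in> I \<Longrightarrow> g \<in> I \<Longrightarrow> f - g \<in> I"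
  for I :: "'a::comm_ring_1 set"
  using ideal_add[of I f "(-1) * g"] ideal_mult[of I g "-1"] by simp

lemma ideal_sum: "is_ideal I \<Longrightarrow> (\<And>x. x \<in> A \<Longrightarrow> f x \<in> I) \<Longrightarrow> sum f A \<in> I"
  by (induction A rule: infinite_finite_induct) (simp_all add: ideal_zero ideal_add)

lemma homogeneous_iff_coef: "homogeneous d f \<longleftrightarrow> (\<forall>u. mdeg u \<noteq> d \<longrightarrow> coef f u = 0)"
  by (auto simp: homogeneous_def in_keys_iff)

lift_definition component :: "nat \<Rightarrow> 'a::zero poly3 \<Rightarrow> 'a poly3" is
  "\<lambda>d f u. if mdeg u = d then f u else 0"
  by (rule finite_subset) auto

lemma homogeneous_component [simp]: "homogeneous d (component d f)"
  unfolding homogeneous_def in_keys_iff by transfer auto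

text \<open>
  The ideal generated by the homogeneous elements contains each of its elements as the finite sum of its
  components.
\<close>

lemma homogeneous_idealI:
  assumes I: "is_ideal I" and "\<And>f d. f \<in> I \<Longrightarrow> component d f \<in> I"
  shows "homogeneous_ideal I"
proof -
  let ?H = "{f \<in> I. \<exists>d. homogeneous d f}"
  have "f \<in> ideal_gen ?H" if "f \<in> I" for f
  proof -
    have "(\<Sum>d\<in>mdeg ` Poly_Mapping.keys f. component d f) \<in> ideal_gen ?H"
      by (rule ideal_sum[OF is_ideal_ideal_gen], rule hull_inc)
        (use homogeneous_component in \<open>blast intro: assms that\<close>)
    also have "(\<Sum>d\<in>mdeg ` Poly_Mapping.keys f. component d f) = f"
      by (rule poly_mapping_eqI)
        (auto simp: lookup_sum component.rep_eq sum.delta in_keys_iff)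
    finally show ?thesis .
  qed
  moreover have "ideal_gen ?H \<subseteq> I" by (rule hull_minimal) (auto simp: I)
  ultimately show ?thesis using I by (auto simp: homogeneous_ideal_def)
qed

lemma irrelevant_ideal_coef_0: "f \<in> irrelevant_ideal \<Longrightarrow> coef f 0 = 0"
proof -
  have "irrelevant_ideal \<subseteq> {f :: 'a poly3. coef f 0 = 0}"
    unfolding irrelevant_ideal_def
    by (rule hull_minimal)
      (auto simp: is_ideal_def lookup_add coef_0_mult variable_conv_mon lookup_single when_def)
  then show "f \<in> irrelevant_ideal \<Longrightarrow> coef f 0 = 0" for f :: "'a poly3" by auto
qed

lemma is_ideal_irrelevant: "is_ideal irrelevant_ideal"
  unfolding irrelevant_ideal_def by (rule is_ideal_ideal_gen)

lemma variable_in_irrelevant: "variable i \<in> irrelevant_ideal"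
  unfolding irrelevant_ideal_def by (rule hull_inc) (cases i; simp)

section \<open>Ideals cut out by a linear condition on quadrics\<close>

text \<open>
  Over a field these are the linear subspaces of triples; over the tropical semiring they are the
  subsemimodules. Treating both at once gives the ideals and their common tropicalisation the same shape.
\<close>

definition linear_condition :: "('a::comm_semiring_1 \<Rightarrow> 'a \<Rightarrow> 'a \<Rightarrow> bool) \<Rightarrow> bool" where
  "linear_condition P \<longleftrightarrow> P 0 0 0 \<and>
     (\<forall>a b c a' b' c'. P a b c \<longrightarrow> P a' b' c' \<longrightarrow> P (a + a') (b + b') (c + c')) \<and>
     (\<forall>r a b c. P a b c \<longrightarrow> P (r * a) (r * b) (r * c))"

definition quad_ideal :: "('a \<Rightarrow> 'a \<Rightarrow> 'a \<Rightarrow> bool) \<Rightarrow> 'a::comm_semiring_1 poly3 set" where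
  "quad_ideal P = {f.
     (\<forall>a b n. a + b < 2 \<longrightarrow> coef f (mon a b n) = 0) \<and>
     (\<forall>n. P (coef f (mon 2 0 n)) (coef f (mon 1 1 n)) (coef f (mon 0 2 n)))}"

text \<open>
  Multiplication by a power of \<open>z\<close> shifts the triples of coefficients, and multiplication by a monomial that
  involves \<open>x\<close> or \<open>y\<close> moves the quadratic coefficients to degree at least three, where nothing is required.
\<close>

lemma is_ideal_quad_ideal:
  assumes P: "linear_condition P"
  shows "is_ideal (quad_ideal P)"
proof (rule is_idealI_terms)
  show "0 \<in> quad_ideal P" using P by (simp add: quad_ideal_def linear_condition_def)
  show "f + g \<in> quad_ideal P" if "f \<in> quad_ideal P" "g \<in> quad_ideal P" for f g
    using P that by (simp add: quad_ideal_def linear_condition_def lookup_add)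
next
  fix f i j k r
  assume f: "f \<in> quad_ideal P"
  let ?g = "Poly_Mapping.single (mon i j k) r * f"
  have low: "coef f (mon a b n) = 0" if "a + b < 2" for a b n
    using f that by (simp add: quad_ideal_def)
  have "P (coef ?g (mon 2 0 n)) (coef ?g (mon 1 1 n)) (coef ?g (mon 0 2 n))" for n
  proof (cases "i = 0 \<and> j = 0 \<and> k \<le> n")
    case True
    then show ?thesis using f P by (simp add: coef_term_mult quad_ideal_def linear_condition_def)
  next
    case False
    then have "coef ?g (mon a b n) = 0" if "a + b = 2" for a b
      using that by (auto simp: coef_term_mult low)
    then show ?thesis using P by (simp add: linear_condition_def)
  qed
  then show "?g \<in> quad_ideal P" by (auto simp: quad_ideal_def coef_term_mult low)
qed

lemma term_in_quad_ideal:
  "linear_condition P \<Longrightarrow> a + b \<ge> 3 \<Longrightarrow> Poly_Mapping.single (mon a b n) r \<in> quad_ideal P"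
  by (auto simp: quad_ideal_def linear_condition_def lookup_single when_def)

text \<open>
  The three monomials in one condition have the same degree \<open>n + 2\<close>, so a homogeneous component keeps
  either all or none of them.
\<close>

lemma homogeneous_quad_ideal:
  assumes P: "linear_condition P"
  shows "homogeneous_ideal (quad_ideal P)"
proof (rule homogeneous_idealI[OF is_ideal_quad_ideal[OF P]])
  fix f d
  assume f: "f \<in> quad_ideal P"
  have "P (coef (component d f) (mon 2 0 n)) (coef (component d f) (mon 1 1 n))
    (coef (component d f) (mon 0 2 n))" for n
    using f P by (cases "n + 2 = d") (simp_all add: component.rep_eq quad_ideal_def linear_condition_def)
  then show "component d f \<in> quad_ideal P"
    using f by (simp add: quad_ideal_def component.rep_eq)
qed

lemma Z_power_in_irrelevant_power:
  "Poly_Mapping.single (mon 0 0 n) 1 \<in> ideal_power (irrelevant_ideal :: 'a::comm_semiring_1 poly3 set) n"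
proof (induction n)
  case (Suc n)
  have "variable Z * Poly_Mapping.single (mon 0 0 n) 1 \<in> ideal_power (irrelevant_ideal :: 'a poly3 set) (Suc n)"
    unfolding ideal_power.simps
    by (rule hull_inc) (use Suc variable_in_irrelevant in blast)
  then show ?case by (simp add: variable_conv_mon mult_single)
qed simp

text \<open>
  Multiplication by \<open>z\<^sup>n\<close> shifts the coefficients without changing the conditions on them, so \<open>z\<close> is a
  nonzerodivisor modulo the ideal.
\<close>

lemma saturated_quad_ideal:
  assumes P: "linear_condition P"
  shows "saturated (quad_ideal P)"
proof -
  have "f \<in> quad_ideal P" if f: "f \<in> ideal_quotient (quad_ideal P) (ideal_power irrelevant_ideal n)" for f n
  proof -
    let ?z = "Poly_Mapping.single (mon 0 0 n) 1"
    have z: "?z * f \<in> quad_ideal P"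
      using f Z_power_in_irrelevant_power[of n] by (auto simp: ideal_quotient_def mult.commute)
    have "coef f (mon a b m) = coef (?z * f) (mon a b (m + n))" for a b m
      by (simp add: coef_term_mult)
    then show ?thesis using z by (simp add: quad_ideal_def)
  qed
  moreover have "f \<in> ideal_quotient (quad_ideal P) (ideal_power irrelevant_ideal 0)" if "f \<in> quad_ideal P" for f
    using ideal_mult[OF is_ideal_quad_ideal[OF P] that] by (simp add: ideal_quotient_def mult.commute)
  ultimately show ?thesis unfolding saturated_def saturation_def by blast
qed

section \<open>The tropical ideal\<close>

text \<open>
  The order is the one of the real numbers, so the tropical zero is the greatest element.
\<close>

lemma tropical_simps [simp]: "Infty = (0::tropical)" "(a::tropical) \<le> 0" "Fin 0 = 1"
  "(0::tropical) \<le> a \<longleftrightarrow> a = 0"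
  by (cases a; simp add: zero_tropical_def one_tropical_def)+

lemma tropical_le_add_iff [simp]: "(c::tropical) \<le> a + b \<longleftrightarrow> c \<le> a \<and> c \<le> b"
  and tropical_add_le_iff: "a + b \<le> (c::tropical) \<longleftrightarrow> a \<le> c \<or> b \<le> c"
  by (auto simp: plus_tropical_def min_le_iff_disj)

lemma tropical_mult_left_mono: "(a::tropical) \<le> b \<Longrightarrow> r * a \<le> r * b"
  by (cases r; cases a; cases b) auto

lemma tropical_square_eq_1: "t * t = 1 \<Longrightarrow> t = 1" for t :: tropical
  by (cases t) (auto simp: one_tropical_def simp del: tropical_simps)

text \<open>
  The tropicalised plane: the minimum of the three values is attained at least twice.
\<close>

definition trop_plane :: "tropical \<Rightarrow> tropical \<Rightarrow> tropical \<Rightarrow> bool" where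
  "trop_plane a b c \<longleftrightarrow> b + c \<le> a \<and> a + c \<le> b \<and> a + b \<le> c"

lemma linear_condition_trop_plane: "linear_condition trop_plane"
proof -
  have "trop_plane (r * a) (r * b) (r * c)" if "trop_plane a b c" for r a b c
    using that tropical_mult_left_mono[of _ _ r]
    by (auto simp: trop_plane_def simp flip: distrib_left)
  moreover have "trop_plane (a + a') (b + b') (c + c')" if "trop_plane a b c" "trop_plane a' b' c'"
    for a b c a' b' c'
    using that by (auto simp: trop_plane_def tropical_add_le_iff)
  ultimately show ?thesis by (simp add: linear_condition_def trop_plane_def)
qed

text \<open>
  If the two triples differ in both remaining places, then the minima
  there coincide: a strict inequality between them would make the minimum of one of the triples be attained only once.
\<close>

lemma trop_plane_elimination:
  assumes "trop_plane a b c" "trop_plane a b' c'"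
  obtains s where "b + b' \<le> s" "c + c' \<le> s" "b \<noteq> b' \<longrightarrow> s = b + b'" "c \<noteq> c' \<longrightarrow> s = c + c'"
proof -
  have "\<exists>s. b + b' \<le> s \<and> c + c' \<le> s \<and> (b \<noteq> b' \<longrightarrow> s = b + b') \<and> (c \<noteq> c' \<longrightarrow> s = c + c')"
    (is "\<exists>s. ?Q s")
  proof -
    \<comment> \<open>In a place where the triples agree, any value not below the common one is admissible.\<close>
    have "?Q (if b \<noteq> b' then b + b' else if c \<noteq> c' then c + c' else max b c)"
      using assms unfolding trop_plane_def plus_tropical_def min_def max_def
      by (smt (verit) linear order_antisym order_trans)
    then show ?thesis by blast
  qed
  then show ?thesis using that by blast
qed

text \<open>
  At a monomial of degree at least three in \<open>x, y\<close> the coefficient of the sum can simply be deleted. At one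
  of the three monomials of a condition, deleting it forces the other two coefficients to be equal, and
  \<open>trop_plane_elimination\<close> provides their common value.
\<close>

lemma tropical_ideal_elimination:
  assumes f: "f \<in> graded_piece (quad_ideal trop_plane) d" 
    and g: "g \<in> graded_piece (quad_ideal trop_plane) d"
    and u: "mdeg u = d" "coef f u = coef g u" "coef f u \<noteq> Infty"
  shows "\<exists>h\<in>graded_piece (quad_ideal trop_plane) d. coef h u = Infty \<and>
           (\<forall>v. min (coef f v) (coef g v) \<le> coef h v \<and>
                (coef f v \<noteq> coef g v \<longrightarrow> coef h v = min (coef f v) (coef g v)))"
proof -
  let ?J = "quad_ideal trop_plane"
  note add = is_ideal_quad_ideal[OF linear_condition_trop_plane, THEN ideal_add]
  have fg: "f + g \<in> ?J" using add f g by (simp add: graded_piece_def)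
  have hom: "homogeneous d (f + g)" using f g by (simp add: graded_piece_def homogeneous_iff_coef lookup_add)
  have low: "coef f (mon a b n) = 0" "coef g (mon a b n) = 0" if "a + b < 2" for a b n
    using f g that by (simp_all add: graded_piece_def quad_ideal_def)
  have quad: "trop_plane (coef f (mon 2 0 n)) (coef f (mon 1 1 n)) (coef f (mon 0 2 n))"
    "trop_plane (coef g (mon 2 0 n)) (coef g (mon 1 1 n)) (coef g (mon 0 2 n))"  for n
    using f g by (simp_all add: graded_piece_def quad_ideal_def)
  obtain a b n where mon: "u = mon a b n" by (rule mon_cases)
  show ?thesis
  proof (cases "a + b = 2")
    case False
    then have "a + b \<ge> 3" using low(1)[of a b n] u(3) by (fastforce simp: mon)
    let ?h = "Poly_Mapping.update u 0 (f + g)"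
    have "?h \<in> ?J" using \<open>a + b \<ge> 3\<close> fg by (auto simp: quad_ideal_def lookup_update mon)
    moreover have "homogeneous d ?h" using hom by (simp add: homogeneous_iff_coef lookup_update)
    ultimately show ?thesis using u
      by (intro bexI[of _ ?h]) (auto simp: graded_piece_def lookup_update lookup_add plus_tropical_def)
  next
    case True
    have *: ?thesis if v: "{u, v, w} = {mon 2 0 n, mon 1 1 n, mon 0 2 n}" "distinct [u, v, w]"
      and tp: "trop_plane (coef f u) (coef f v) (coef f w)" "trop_plane (coef g u) (coef g v) (coef g w)"
    for v w
    proof -
      obtain s where s: "coef f v + coef g v \<le> s" "coef f w + coef g w \<le> s"
        "coef f v \<noteq> coef g v \<longrightarrow> s = coef f v + coef g v"
        "coef f w \<noteq> coef g w \<longrightarrow> s = coef f w + coef g w"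
        by (rule trop_plane_elimination[OF tp(1) tp(2)[folded u(2)]])
      let ?h = "Poly_Mapping.update u 0 (Poly_Mapping.update v s (Poly_Mapping.update w s (f + g)))"
      let ?Q = "{mon 2 0 n, mon 1 1 n, mon 0 2 n}"
      have "v \<in> ?Q" "w \<in> ?Q" using v(1) by blast+
      then have deg: "mdeg v = d" "mdeg w = d" using u(1) True by (auto simp: mon)
      have outside: "coef ?h z = coef (f + g) z" if "z \<notin> ?Q" for z
        using that unfolding v(1)[symmetric] by (auto simp: lookup_update)
      have inside: "coef ?h u = 0" "coef ?h v = s" "coef ?h w = s"
        using v(2) by (auto simp: lookup_update)
      have "trop_plane (coef ?h (mon 2 0 m)) (coef ?h (mon 1 1 m)) (coef ?h (mon 0 2 m))" for m
      proof (cases "m = n")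
        case True
        have "mon 2 0 n = u \<or> mon 2 0 n = v \<or> mon 2 0 n = w"
          "mon 1 1 n = u \<or> mon 1 1 n = v \<or> mon 1 1 n = w"
          "mon 0 2 n = u \<or> mon 0 2 n = v \<or> mon 0 2 n = w"
          using v(1) by blast+
        then have "trop_plane (coef ?h (mon 2 0 n)) (coef ?h (mon 1 1 n)) (coef ?h (mon 0 2 n))"
          by (elim disjE) (simp_all only: inside, auto simp: trop_plane_def)
        then show ?thesis by (simp only: True)
      next
        case False
        have "trop_plane (coef (f + g) (mon 2 0 m)) (coef (f + g) (mon 1 1 m)) (coef (f + g) (mon 0 2 m))"
          using fg by (simp add: quad_ideal_def)
        moreover have "coef ?h (mon i j m) = coef (f + g) (mon i j m)" for i j
          by (rule outside) (use False in auto)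
        ultimately show ?thesis by (simp only:)
      qed
      moreover have "coef ?h (mon i j m) = 0" if "i + j < 2" for i j m
      proof -
        have "coef ?h (mon i j m) = coef (f + g) (mon i j m)" by (rule outside) (use that in auto)
        also have "\<dots> = 0" using low that by (simp add: lookup_add)
        finally show ?thesis .
      qed
      ultimately have "?h \<in> ?J" by (simp only: quad_ideal_def mem_Collect_eq) blast
      moreover have "homogeneous d ?h" using hom u(1) deg by (auto simp: homogeneous_iff_coef lookup_update)
      ultimately show ?thesis using s v(2) u(2)
        by (intro bexI[of _ ?h])
          (auto simp: graded_piece_def lookup_update lookup_add simp flip: plus_tropical_def)
    qed
    from True consider "a = 2" "b = 0" | "a = 1" "b = 1" | "a = 0" "b = 2" by linarith
    then show ?thesis
    proof cases
      case 1
      then show ?thesis using *[of "mon 1 1 n" "mon 0 2 n"] quad by (simp add: mon)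
    next
      case 2
      then show ?thesis using *[of "mon 2 0 n" "mon 0 2 n"] quad 
        by (simp add: mon trop_plane_def add.commute insert_commute)
    next
      case 3
      then show ?thesis using *[of "mon 2 0 n" "mon 1 1 n"] quad
        by (simp add: mon trop_plane_def add.commute insert_commute)
    qed
  qed
qed

lemma homogeneous_tropical_ideal_quad_ideal: "homogeneous_tropical_ideal (quad_ideal trop_plane)"
  unfolding homogeneous_tropical_ideal_def
  using homogeneous_quad_ideal[OF linear_condition_trop_plane] tropical_ideal_elimination by blast

section \<open>Realisations of the tropical ideal\<close>

text \<open>
  The kernel of the functional \<open>(1, 1, l)\<close>.
\<close>

definition plane :: "'k::field \<Rightarrow> 'k \<Rightarrow> 'k \<Rightarrow> 'k \<Rightarrow> bool" where
  "plane l p q r \<longleftrightarrow> p + q + l * r = 0"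

lemma linear_condition_plane: "linear_condition (plane l)"
proof -
  have "(p + p') + (q + q') + l * (r + r') = 0" if "p + q + l * r = 0" "p' + q' + l * r' = 0"
    for p q r p' q' r'
  proof -
    have "(p + p') + (q + q') + l * (r + r') = (p + q + l * r) + (p' + q' + l * r')"
      by (simp add: algebra_simps)
    then show ?thesis using that by simp
  qed
  moreover have "s * p + s * q + l * (s * r) = 0" if "p + q + l * r = 0" for s p q r
  proof -
    have "s * p + s * q + l * (s * r) = s * (p + q + l * r)" by (simp add: algebra_simps)
    then show ?thesis using that by simp
  qed
  ultimately show ?thesis by (simp add: linear_condition_def plane_def)
qed

lemmas is_ideal_quad_plane = is_ideal_quad_ideal[OF linear_condition_plane]

context
  fixes \<nu> :: "'k::field \<Rightarrow> tropical"
  assumes \<nu>: "valuation \<nu>"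
begin

lemma val_eq_0_iff [simp]: "\<nu> a = 0 \<longleftrightarrow> a = 0"
  and val_mult: "\<nu> (a * b) = \<nu> a * \<nu> b"
  and val_add: "\<nu> a + \<nu> b \<le> \<nu> (a + b)"
  using \<nu> by (simp_all add: valuation_def plus_tropical_def)

lemma val_1 [simp]: "\<nu> 1 = 1"
proof -
  have "\<nu> 1 * \<nu> 1 = \<nu> 1" by (simp flip: val_mult)
  moreover have "\<nu> 1 \<noteq> Infty" by simp
  ultimately show ?thesis
    by (cases "\<nu> 1") (auto simp: one_tropical_def simp del: tropical_simps)
qed

lemma val_minus [simp]: "\<nu> (- a) = \<nu> a"
proof -
  have "\<nu> (- 1) = 1" by (rule tropical_square_eq_1) (simp flip: val_mult)
  then show ?thesis using val_mult[of "-1" a] by simp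
qed

text \<open>
  Each of the summands \<open>p\<close>, \<open>q\<close>, \<open>l r\<close> is the negative of the sum of the other two.
\<close>

lemma trop_plane_val:
  assumes l: "\<nu> l = 1" and "plane l p q r"
  shows "trop_plane (\<nu> p) (\<nu> q) (\<nu> r)"
proof -
  have "p = - (q + l * r)" "q = - (p + l * r)" "l * r = - (p + q)"
    using assms(2) unfolding plane_def eq_neg_iff_add_eq_0 by (simp_all only: ac_simps)
  note this[THEN arg_cong, of \<nu>]
  then have "\<nu> p = \<nu> (q + l * r)" "\<nu> q = \<nu> (p + l * r)" "\<nu> (l * r) = \<nu> (p + q)"
    by (simp_all only: val_minus)
  moreover have "\<nu> (l * r) = \<nu> r" by (simp add: val_mult l)
  ultimately show ?thesis
    using val_add[of q "l * r"] val_add[of p "l * r"] val_add[of p q] by (simp add: trop_plane_def)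
qed

lemma coef_trop_poly: "coef (trop_poly \<nu> f) u = \<nu> (coef f u)"
  by (simp add: trop_poly_def coef_map)

text \<open>
  The circuits of the plane: forms in the ideal with two terms, both with coefficients of valuation zero.
\<close>

lemma quadric_circuit:
  assumes l: "\<nu> l = 1"
    and uv: "u \<in> {mon 2 0 n, mon 1 1 n, mon 0 2 n}" "v \<in> {mon 2 0 n, mon 1 1 n, mon 0 2 n}" "u \<noteq> v"
  shows "Poly_Mapping.single u 1 + Poly_Mapping.single v 1 \<in> trop_ideal \<nu> (quad_ideal (plane l))"
proof -
  have *: "Poly_Mapping.single u 1 + Poly_Mapping.single v 1 \<in> trop_ideal \<nu> (quad_ideal (plane l))"
    if f: "Poly_Mapping.single u a + Poly_Mapping.single v b \<in> quad_ideal (plane l)"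
      and ab: "\<nu> a = 1" "\<nu> b = 1" "u \<noteq> v" for u v a b
  proof -
    have "trop_poly \<nu> (Poly_Mapping.single u a + Poly_Mapping.single v b) =
      Poly_Mapping.single u 1 + Poly_Mapping.single v 1"
      using ab by (intro poly_mapping_eqI) (auto simp: coef_trop_poly lookup_add lookup_single when_def)
    then show ?thesis unfolding trop_ideal_def by (metis f hull_inc image_eqI)
  qed
  have "Poly_Mapping.single (mon 2 0 n) 1 + Poly_Mapping.single (mon 1 1 n) (- 1) \<in> quad_ideal (plane l)"
    "Poly_Mapping.single (mon 2 0 n) l + Poly_Mapping.single (mon 0 2 n) (- 1) \<in> quad_ideal (plane l)"
    "Poly_Mapping.single (mon 1 1 n) l + Poly_Mapping.single (mon 0 2 n) (- 1) \<in> quad_ideal (plane l)"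
    by (auto simp: quad_ideal_def plane_def lookup_add lookup_single when_def)
  note this[THEN *]
  with uv l show ?thesis by (auto simp: add.commute)
qed

text \<open>
  For the inclusion of the right-hand side, the idempotency of the tropical addition allows each coefficient of \<open>F\<close>
  to be dealt with separately: it suffices to find, for each monomial of \<open>F\<close>, an element of the
  left-hand side that lies above \<open>F\<close> and agrees with it at that monomial. At a quadratic monomial this
  is a multiple of the circuit that joins it to another one whose coefficient is not larger.
\<close>

lemma trop_ideal_quad_plane:
  assumes l: "\<nu> l = 1"
  shows "trop_ideal \<nu> (quad_ideal (plane l)) = quad_ideal trop_plane" (is "?T = ?J")
proof
  have "trop_poly \<nu> f \<in> ?J" if "f \<in> quad_ideal (plane l)" for f
    using that trop_plane_val[OF l] by (simp add: quad_ideal_def coef_trop_poly)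
  then show "?T \<subseteq> ?J" unfolding trop_ideal_def
    by (intro hull_minimal) (auto intro: is_ideal_quad_ideal linear_condition_trop_plane)
next
  have ideal: "is_ideal ?T" unfolding trop_ideal_def by (rule is_ideal_ideal_gen)
  show "?J \<subseteq> ?T"
  proof
    fix F
    assume F: "F \<in> ?J"
    have "\<exists>G. G \<in> ?T \<and> coef G u = coef F u \<and> (\<forall>w. coef F w \<le> coef G w)"
      if u: "u \<in> Poly_Mapping.keys F" for u
    proof -
      obtain a b n where mon: "u = mon a b n" by (rule mon_cases)
      have "a + b \<ge> 2" using u F by (force simp: mon quad_ideal_def in_keys_iff)
      then consider "a + b \<ge> 3" | "a + b = 2" by linarith
      then show ?thesis
      proof cases
        case 1
        have "trop_poly \<nu> (Poly_Mapping.single u 1) \<in> ?T"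
          unfolding trop_ideal_def mon
          by (intro hull_inc imageI term_in_quad_ideal linear_condition_plane 1)
        also have "trop_poly \<nu> (Poly_Mapping.single u 1) = Poly_Mapping.single u 1"
          by (intro poly_mapping_eqI) (auto simp: coef_trop_poly lookup_single when_def)
        finally have "Poly_Mapping.single 0 (coef F u) * Poly_Mapping.single u 1 \<in> ?T"
          by (rule ideal_mult[OF ideal])
        then show ?thesis
          by (intro exI[of _ "Poly_Mapping.single u (coef F u)"])
            (auto simp: mult_single lookup_single when_def)
      next
        case 2
        let ?Q = "{mon 2 0 n, mon 1 1 n, mon 0 2 n}"
        have uQ: "u \<in> ?Q" using 2 by (auto simp: mon)
        have "trop_plane (coef F (mon 2 0 n)) (coef F (mon 1 1 n)) (coef F (mon 0 2 n))"
          using F by (simp add: quad_ideal_def)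
        then obtain v where v: "v \<in> ?Q" "u \<noteq> v" "coef F v \<le> coef F u"
          using uQ unfolding trop_plane_def tropical_add_le_iff by fastforce
        have "Poly_Mapping.single 0 (coef F u) * (Poly_Mapping.single u 1 + Poly_Mapping.single v 1) \<in> ?T"
          by (intro ideal_mult[OF ideal] quadric_circuit[where n = n] l uQ v)
        then show ?thesis using v(2,3)
          by (intro exI[of _ "Poly_Mapping.single u (coef F u) + Poly_Mapping.single v (coef F u)"])
            (auto simp: distrib_left mult_single lookup_add lookup_single when_def)
      qed
    qed
    then obtain G where G: "G u \<in> ?T" "coef (G u) u = coef F u" "coef F w \<le> coef (G u) w"
      if "u \<in> Poly_Mapping.keys F" for u w by metis
    have "F = (\<Sum>u\<in>Poly_Mapping.keys F. G u)"
    proof (rule poly_mapping_eqI)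
      fix w
      have "coef F w \<le> (\<Sum>u\<in>A. coef (G u) w)" if "A \<subseteq> Poly_Mapping.keys F" for A
        using that by (induction A rule: infinite_finite_induct) (auto simp: G)
      moreover have "(\<Sum>u\<in>Poly_Mapping.keys F. coef (G u) w) \<le> coef F w"
      proof (cases "w \<in> Poly_Mapping.keys F")
        case True
        then show ?thesis using G(2)[of w]
          by (subst sum.remove[of _ w]) (auto simp: tropical_add_le_iff)
      qed (simp add: in_keys_iff)
      ultimately show "coef F w = coef (\<Sum>u\<in>Poly_Mapping.keys F. G u) w"
        by (simp add: lookup_sum order_antisym)
    qed
    also have "\<dots> \<in> ?T" by (rule ideal_sum[OF ideal]) (rule G(1))
    finally show "F \<in> ?T" .
  qed
qed

end

text \<open>
  The form \<open>l x y - y\<^sup>2\<close> satisfies the condition for no parameter other than \<open>l\<close>.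
\<close>

lemma quad_plane_inject:
  assumes "quad_ideal (plane l) = quad_ideal (plane m)"
  shows "l = m"
proof -
  have mem: "Poly_Mapping.single (mon 1 1 0) l + Poly_Mapping.single (mon 0 2 0) (- 1) \<in> quad_ideal (plane k) \<longleftrightarrow> l = k" for k
    by (auto simp: quad_ideal_def plane_def lookup_add lookup_single when_def)
  show ?thesis using mem[of l] mem[of m] assms by simp
qed

section \<open>Generators and syzygies\<close>

abbreviation scalar :: "'a::zero \<Rightarrow> 'a poly3" where
  "scalar c \<equiv> Poly_Mapping.single 0 c"

abbreviation x :: "'a::zero_neq_one poly3" where "x \<equiv> variable X"
abbreviation y :: "'a::zero_neq_one poly3" where "y \<equiv> variable Y"

text \<open>
  A basis of the quadratic forms in the plane, factored into linear forms.
\<close>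

abbreviation quadric1 :: "'k::field poly3" where "quadric1 \<equiv> x * (x - y)"
abbreviation quadric2 :: "'k::field \<Rightarrow> 'k poly3" where "quadric2 l \<equiv> y * (scalar l * x - y)"

lemma quadrics_conv:
  "quadric1 = Poly_Mapping.single (mon 2 0 0) 1 - Poly_Mapping.single (mon 1 1 0) (1 :: 'k::field)"
  "quadric2 l = Poly_Mapping.single (mon 1 1 0) l - Poly_Mapping.single (mon 0 2 0) 1"
  by (simp_all add: variable_conv_mon right_diff_distrib mult_single numeral_2_eq_2)

lemma cube_conv: "y ^ 3 = Poly_Mapping.single (mon 0 3 0) (1 :: 'k::field)"
  by (simp add: variable_conv_mon power3_eq_cube mult_single numeral_3_eq_3)

lemma generators_in_quad_plane:
  "quadric1 \<in> quad_ideal (plane l)" "quadric2 l \<in> quad_ideal (plane l)" "y ^ 3 \<in> quad_ideal (plane l)"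
  unfolding quadrics_conv cube_conv
  by (auto simp: quad_ideal_def plane_def lookup_minus lookup_single when_def)

text \<open>
  Modulo the two quadrics, \<open>x\<^sup>3\<close>, \<open>x\<^sup>2 y\<close> and \<open>x y\<^sup>2\<close> agree up to units with \<open>y\<^sup>3\<close>.
\<close>

lemma cubic_terms_in_ideal:
  fixes l :: "'k::field"
  assumes K: "is_ideal K" and "l \<noteq> 0" "quadric1 \<in> K" "quadric2 l \<in> K" "y ^ 3 \<in> K" and ab: "a + b \<ge> 3"
  shows "Poly_Mapping.single (mon a b n) 1 \<in> K"
proof -
  let ?L = "scalar (1 / l)" 
  have L: "?L * scalar l = 1" using \<open>l \<noteq> 0\<close> by (simp add: mult_single)
  have "?L * (y ^ 3 + y * quadric2 l) = (?L * scalar l) * (x * y ^ 2)"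
    by (simp add: algebra_simps power2_eq_square power3_eq_cube)
  moreover have "?L * (y ^ 3 + y * quadric2 l) \<in> K" by (intro ideal_mult ideal_add K assms)
  ultimately have xyy: "x * y ^ 2 \<in> K" unfolding L by (simp only: mult_1)
  have "y * quadric1 + x * y ^ 2 \<in> K" by (intro ideal_mult ideal_add K assms xyy)
  also have "y * quadric1 + x * y ^ 2 = x ^ 2 * y"
    by (simp add: algebra_simps power2_eq_square)
  finally have xxy: "x ^ 2 * y \<in> K" .
  have "x * quadric1 + x ^ 2 * y \<in> K" by (intro ideal_mult ideal_add K assms xxy)
  also have "x * quadric1 + x ^ 2 * y = x ^ 3"
    by (simp add: algebra_simps power2_eq_square power3_eq_cube)
  finally have xxx: "x ^ 3 \<in> K" .
  have conv: "x ^ 3 = Poly_Mapping.single (mon 3 0 0) (1::'k)" "x ^ 2 * y = Poly_Mapping.single (mon 2 1 0) (1::'k)"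
    "x * y ^ 2 = Poly_Mapping.single (mon 1 2 0) (1::'k)"
    by (simp_all add: variable_conv_mon power2_eq_square power3_eq_cube mult_single eval_nat_numeral)
  have *: "Poly_Mapping.single (mon a b n) 1 \<in> K"
    if "Poly_Mapping.single (mon i j 0) 1 \<in> K" "i \<le> a" "j \<le> b" for i j
    using ideal_mult[OF K that(1), of "Poly_Mapping.single (mon (a - i) (b - j) n) 1"] that(2,3)
    by (simp add: mult_single)
  from ab consider "a \<ge> 3" | "a = 2" "b \<ge> 1" | "a = 1" "b \<ge> 2" | "b \<ge> 3" by linarith
  then show ?thesis
    using *[of 3 0] *[of 2 1] *[of 1 2] *[of 0 3] xxx xxy xyy \<open>y ^ 3 \<in> K\<close> unfolding conv cube_conv
    by cases auto
qed

text \<open>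
  Modulo the generators every element of the ideal is congruent to a combination of the monomials \<open>x y z\<^sup>n\<close>. Such a combination
  satisfies the condition only if it is zero.
\<close>

lemma quad_plane_subset_ideal:
  fixes l :: "'k::field"
  assumes K: "is_ideal K" and gens: "l \<noteq> 0" "quadric1 \<in> K" "quadric2 l \<in> K" "y ^ 3 \<in> K"
  shows "quad_ideal (plane l) \<subseteq> K"
proof
  fix p
  assume p: "p \<in> quad_ideal (plane l)"
  define E where "E = range (mon 1 1)"
  note I = is_ideal_quad_plane[of l]
  \<comment> \<open>The leading monomial of t is u if the monomials in E count as lower terms.\<close>
  have "\<exists>t. t \<in> K \<and> t \<in> quad_ideal (plane l) \<and> (\<forall>v. v \<notin> E \<longrightarrow> coef t v = (if v = u then 1 else 0))"
    if u: "u \<in> Poly_Mapping.keys p - E" for u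
  proof -
    obtain a b n where mon: "u = mon a b n" by (rule mon_cases)
    have "a + b \<ge> 2" using u p by (force simp: mon quad_ideal_def in_keys_iff)
    moreover have "\<not> (a = 1 \<and> b = 1)" using u by (auto simp: E_def mon)
    ultimately consider "a + b \<ge> 3" | "a = 2" "b = 0" | "a = 0" "b = 2" by linarith
    then show ?thesis
    proof cases
      case 1
      show ?thesis
        using cubic_terms_in_ideal[OF K gens 1] term_in_quad_ideal[OF linear_condition_plane 1]
        by (intro exI[of _ "Poly_Mapping.single u 1"]) (auto simp: lookup_single when_def mon)
    next
      case 2
      let ?t = "Poly_Mapping.single (mon 0 0 n) 1 * quadric1"
      have t: "?t = Poly_Mapping.single (mon 2 0 n) 1 - Poly_Mapping.single (mon 1 1 n) 1"
        unfolding quadrics_conv by (simp add: right_diff_distrib mult_single numeral_2_eq_2)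
      have "\<forall>v. v \<notin> E \<longrightarrow> coef ?t v = (if v = u then 1 else 0)"
        using 2 unfolding t by (auto simp: lookup_minus lookup_single when_def mon E_def)
      moreover have "?t \<in> K" "?t \<in> quad_ideal (plane l)"
        by (intro ideal_mult K I gens generators_in_quad_plane)+
      ultimately show ?thesis by blast
    next
      case 3
      let ?t = "Poly_Mapping.single (mon 0 0 n) (- 1) * quadric2 l"
      have t: "?t = Poly_Mapping.single (mon 0 2 n) 1 - Poly_Mapping.single (mon 1 1 n) l"
        unfolding quadrics_conv by (simp add: right_diff_distrib mult_single single_uminus numeral_2_eq_2)
      have "\<forall>v. v \<notin> E \<longrightarrow> coef ?t v = (if v = u then 1 else 0)"
        using 3 unfolding t by (auto simp: lookup_minus lookup_single when_def mon E_def)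
      moreover have "?t \<in> K" "?t \<in> quad_ideal (plane l)"
        by (intro ideal_mult K I gens generators_in_quad_plane)+
      ultimately show ?thesis by blast
    qed
  qed
  then obtain t where t: "t u \<in> K" "t u \<in> quad_ideal (plane l)"
      "v \<notin> E \<Longrightarrow> coef (t u) v = (if v = u then 1 else 0)"
    if "u \<in> Poly_Mapping.keys p - E" for u v by metis
  let ?s = "\<Sum>u\<in>Poly_Mapping.keys p - E. scalar (coef p u) * t u"
  have sK: "?s \<in> K" by (intro ideal_sum[OF K] ideal_mult[OF K] t)
  have "?s \<in> quad_ideal (plane l)" by (intro ideal_sum[OF I] ideal_mult[OF I] t)
  then have q: "p - ?s \<in> quad_ideal (plane l)" using ideal_diff[OF I p] by blast
  have off: "coef (p - ?s) v = 0" if v: "v \<notin> E" for v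
  proof -
    have "coef (scalar (coef p u) * t u) v = (if v = u then coef p u else 0)"
      if "u \<in> Poly_Mapping.keys p - E" for u
      using t(3)[OF that v] coef_term_mult[of 0 0 0 "coef p u" "t u"]
      by (cases v rule: mon_cases) (simp add: mon_0)
    then show ?thesis
      using v by (simp add: lookup_minus lookup_sum in_keys_iff sum.delta)
  qed
  have on: "coef (p - ?s) (mon 1 1 n) = 0" for n
  proof -
    have "plane l (coef (p - ?s) (mon 2 0 n)) (coef (p - ?s) (mon 1 1 n)) (coef (p - ?s) (mon 0 2 n))"
      using q unfolding quad_ideal_def by blast
    moreover have "mon 2 0 n \<notin> E" "mon 0 2 n \<notin> E" by (auto simp: E_def)
    ultimately show ?thesis using off by (simp only: plane_def) simp
  qed
  have "p - ?s = 0"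
  proof (rule poly_mapping_eqI)
    show "coef (p - ?s) v = coef 0 v" for v
    proof (cases "v \<in> E")
      case True
      then obtain n where "v = mon 1 1 n" by (auto simp: E_def)
      then show ?thesis by (simp only: on lookup_zero)
    qed (simp only: off lookup_zero not_False_eq_True)
  qed
  then show "p \<in> K" using sK by simp
qed

text \<open>
  The combination \<open>l y quadric1 - x quadric2 = (1 - l) x y\<^sup>2\<close> lies in \<open>K\<close>, and \<open>1 - l\<close> is a unit;
  from \<open>x y\<^sup>2\<close> one obtains \<open>y\<^sup>3\<close> by means of \<open>quadric2\<close>.
\<close>

lemma cube_in_ideal:
  fixes l :: "'k::field"
  assumes K: "is_ideal K" and "l \<noteq> 1" "quadric1 \<in> K" "quadric2 l \<in> K"
  shows "y ^ 3 \<in> K"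
proof -
  let ?C = "scalar (l / (1 - l))"
  have C: "?C * (1 - scalar l) = scalar l"
  proof -
    have "?C * (1 - scalar l) = scalar (l / (1 - l) * (1 - l))"
      by (simp add: right_diff_distrib mult_single single_diff)
    then show ?thesis using \<open>l \<noteq> 1\<close> by simp
  qed
  have "y ^ 3 = (?C * (1 - scalar l)) * (x * y ^ 2) - y * quadric2 l"
    unfolding C by (simp add: algebra_simps power2_eq_square power3_eq_cube)
  also have "\<dots> = ?C * (scalar l * y * quadric1 - x * quadric2 l) - y * quadric2 l"
    by (simp add: algebra_simps power2_eq_square)
  also have "\<dots> \<in> K" by (intro ideal_diff ideal_mult K assms)
  finally show ?thesis .
qed

text \<open>
  The ideal generated by a list, presented with explicit coefficients so that it can be compared with the
  image of a matrix.
\<close>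

definition combinations :: "'a::comm_ring_1 list \<Rightarrow> 'a set" where
  "combinations gs = range (\<lambda>w. \<Sum>b<length gs. gs ! b * w b)"

lemma is_ideal_combinations: "is_ideal (combinations gs)"
proof -
  have 0: "(\<Sum>b<length gs. gs ! b * 0) \<in> combinations gs" 
    unfolding combinations_def by (rule rangeI)
  have add: "(\<Sum>b<length gs. gs ! b * v b) + (\<Sum>b<length gs. gs ! b * w b) =
    (\<Sum>b<length gs. gs ! b * (v b + w b))" for v w
    by (simp add: distrib_left sum.distrib)
  have mult: "r * (\<Sum>b<length gs. gs ! b * w b) = (\<Sum>b<length gs. gs ! b * (r * w b))" for r w
    by (simp add: sum_distrib_left mult.left_commute)
  show ?thesis
    using 0 by (auto simp: is_ideal_def combinations_def add mult)
qed

lemma combinations_subset_iff: "is_ideal K \<Longrightarrow> combinations gs \<subseteq> K \<longleftrightarrow> set gs \<subseteq> K"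
proof
  assume K: "is_ideal K" and gs: "set gs \<subseteq> K"
  have "(\<Sum>b<length gs. w b * gs ! b) \<in> K" for w
    using gs nth_mem by (intro ideal_sum ideal_mult K) blast
  then show "combinations gs \<subseteq> K" by (auto simp: combinations_def mult.commute)
next
  assume sub: "combinations gs \<subseteq> K"
  have "gs ! i \<in> combinations gs" if "i < length gs" for i
  proof -
    have "gs ! i = (\<Sum>b<length gs. gs ! b * (if b = i then 1 else 0))"
      using that by (simp add: if_distrib sum.delta cong: if_cong)
    then show ?thesis unfolding combinations_def
      by (rule range_eqI[of _ _ "\<lambda>b. if b = i then 1 else 0"])
  qed
  with sub show "set gs \<subseteq> K" unfolding subset_iff in_set_conv_nth by blast
qed

lemmas set_subset_combinations = combinations_subset_iff[OF is_ideal_combinations, THEN iffD1, OF order_refl]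

lemma quad_plane_eq_generic:
  fixes l :: "'k::field"
  assumes "l \<noteq> 0" "l \<noteq> 1"
  shows "quad_ideal (plane l) = combinations [quadric1, quadric2 l]" (is "_ = combinations ?gs")
proof
  note K = is_ideal_combinations[of ?gs]
  have "quadric1 \<in> combinations ?gs" "quadric2 l \<in> combinations ?gs"
    using set_subset_combinations[of ?gs] by auto
  with K show "quad_ideal (plane l) \<subseteq> combinations ?gs"
    by (intro quad_plane_subset_ideal cube_in_ideal[where l = l] assms)
  show "combinations ?gs \<subseteq> quad_ideal (plane l)"
    by (simp add: combinations_subset_iff is_ideal_quad_plane generators_in_quad_plane)
qed

lemma quad_plane_eq_special:
  "quad_ideal (plane (1::'k::field)) = combinations [quadric1, quadric2 1, y ^ 3]" (is "_ = combinations ?gs")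
proof
  note K = is_ideal_combinations[of ?gs]
  have "quadric1 \<in> combinations ?gs" "quadric2 1 \<in> combinations ?gs" "y ^ 3 \<in> combinations ?gs"
    using set_subset_combinations[of ?gs] by auto
  with K show "quad_ideal (plane 1) \<subseteq> combinations ?gs"
    by (intro quad_plane_subset_ideal) auto
  show "combinations ?gs \<subseteq> quad_ideal (plane 1)"
    by (simp add: combinations_subset_iff is_ideal_quad_plane generators_in_quad_plane del: single_one)
qed

lemma x_dvd_iff: "x dvd p \<longleftrightarrow> (\<forall>b n. coef p (mon 0 b n) = 0)" for p :: "'k::field poly3"
proof
  assume "\<forall>b n. coef p (mon 0 b n) = 0"
  have "x dvd Poly_Mapping.single u (coef p u)" for u
  proof -
    obtain a b n where u: "u = mon a b n" by (rule mon_cases)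
    show ?thesis
    proof (cases a)
      case 0
      then show ?thesis using \<open>\<forall>b n. coef p (mon 0 b n) = 0\<close> by (simp add: u)
    next
      case (Suc a')
      then have "Poly_Mapping.single u (coef p u) = x * Poly_Mapping.single (mon a' b n) (coef p u)"
        by (simp add: u variable_conv_mon mult_single)
      then show ?thesis by (rule dvdI)
    qed
  qed
  then show "x dvd p" by (subst poly_eq_sum_terms) (rule dvd_sum)
qed (auto simp: dvd_def variable_conv_mon coef_term_mult)

lemma y_dvd_iff: "y dvd p \<longleftrightarrow> (\<forall>a n. coef p (mon a 0 n) = 0)" for p :: "'k::field poly3"
proof
  assume "\<forall>a n. coef p (mon a 0 n) = 0"
  have "y dvd Poly_Mapping.single u (coef p u)" for u
  proof -
    obtain a b n where u: "u = mon a b n" by (rule mon_cases)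
    show ?thesis
    proof (cases b)
      case 0
      then show ?thesis using \<open>\<forall>a n. coef p (mon a 0 n) = 0\<close> by (simp add: u)
    next
      case (Suc b')
      then have "Poly_Mapping.single u (coef p u) = y * Poly_Mapping.single (mon a b' n) (coef p u)"
        by (simp add: u variable_conv_mon mult_single)
      then show ?thesis by (rule dvdI)
    qed
  qed
  then show "y dvd p" by (subst poly_eq_sum_terms) (rule dvd_sum)
qed (auto simp: dvd_def variable_conv_mon coef_term_mult)

lemma coef_x_mult: "coef (x * p) (mon (Suc a) b n) = coef p (mon a b n)"
  and coef_y_mult: "coef (y * p) (mon a (Suc b) n) = coef p (mon a b n)"
  for p :: "'a::comm_semiring_1 poly3"
  by (simp_all add: variable_conv_mon coef_term_mult)

lemma x_dvd_y_mult: "x dvd y * p \<longleftrightarrow> x dvd p" for p :: "'k::field poly3"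
proof
  assume "x dvd y * p"
  then have "coef (y * p) (mon 0 (Suc b) n) = 0" for b n by (simp add: x_dvd_iff)
  then show "x dvd p" by (simp add: x_dvd_iff coef_y_mult)
qed simp

lemma y_dvd_x_mult: "y dvd x * p \<longleftrightarrow> y dvd p" for p :: "'k::field poly3"
proof
  assume "y dvd x * p"
  then have "coef (x * p) (mon (Suc b) 0 n) = 0" for b n by (simp add: y_dvd_iff)
  then show "y dvd p" by (simp add: y_dvd_iff coef_x_mult)
qed simp

lemma variable_neq_0: "variable i \<noteq> (0 :: 'k::field poly3)"
proof
  assume "variable i = (0 :: 'k poly3)"
  then have "coef (variable i :: 'k poly3) (Poly_Mapping.single i 1) = 0" by simp
  then show False by (simp add: variable_def)
qed

lemma x_minus_y_neq_0: "x - y \<noteq> (0 :: 'k::field poly3)"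
proof
  assume "x - y = (0 :: 'k poly3)"
  then have "coef (x - y :: 'k poly3) (mon 1 0 0) = 0" by simp
  then show False by (simp add: variable_conv_mon lookup_minus lookup_single when_def)
qed

text \<open>
  Modulo \<open>x\<close> the linear form is \<open>- y\<close>.
\<close>

lemma x_dvd_linear_mult: "x dvd (c * x - y) * p \<longleftrightarrow> x dvd p" for p :: "'k::field poly3"
proof -
  have "(c * x - y) * p = x * (c * p) - y * p" by (simp add: algebra_simps)
  then show ?thesis using x_dvd_y_mult[of p] by (metis dvd_triv_left dvd_diff_right_iff)
qed

lemma y_dvd_linear_mult: "y dvd (x - y) * p \<longleftrightarrow> y dvd p" for p :: "'k::field poly3"
proof -
  have "(x - y) * p = x * p - y * p" by (simp add: algebra_simps)
  then show ?thesis using y_dvd_x_mult[of p] by (metis dvd_triv_left dvd_diff_left_iff)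
qed

text \<open>
  The two quadrics have no common factor, so all their syzygies are Koszul. The factors \<open>x\<close> and \<open>y\<close> are moved
  across the equation one at a time, and the two remaining linear forms are compared by means of \<open>l x - y = (x - y) + (l - 1) x\<close>, where \<open>l - 1\<close> is a unit.
\<close>

lemma syzygies_generic:
  fixes l :: "'k::field"
  assumes l: "l \<noteq> 1" and rel: "quadric1 * a + quadric2 l * b = 0"
  shows "\<exists>t. a = quadric2 l * t \<and> b = - quadric1 * t"
proof -
  let ?m = "scalar l * x - y :: 'k poly3"
  have "x * ((x - y) * a) = y * (?m * (- b))"
    using rel by (simp add: algebra_simps eq_neg_iff_add_eq_0)
  then have "x dvd y * (?m * (- b))" by (metis dvd_triv_left)
  then have "x dvd - b" by (simp only: x_dvd_y_mult x_dvd_linear_mult)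
  then obtain b1 where b1: "- b = x * b1" by (rule dvdE)
  have "x * ((x - y) * a) = x * (y * (?m * b1))"
    using \<open>x * ((x - y) * a) = y * (?m * (- b))\<close> unfolding b1 by (simp only: ac_simps)
  then have eq1: "(x - y) * a = y * (?m * b1)" by (rule mult_left_cancel[OF variable_neq_0, THEN iffD1])
  then have "y dvd (x - y) * a" by (metis dvd_triv_left)
  then have "y dvd a" by (simp only: y_dvd_linear_mult)
  then obtain a1 where a1: "a = y * a1" by (rule dvdE)
  have "y * ((x - y) * a1) = y * (?m * b1)" using eq1 unfolding a1 by (simp only: ac_simps)
  then have eq2: "(x - y) * a1 = ?m * b1" by (rule mult_left_cancel[OF variable_neq_0, THEN iffD1])
  then have eq3: "(x - y) * (a1 - b1) = x * ((scalar l - 1) * b1)" by (simp add: algebra_simps)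
  then have "x dvd (1 * x - y) * (a1 - b1)" by (metis dvd_triv_left mult_1)
  then have "x dvd a1 - b1" by (simp only: x_dvd_linear_mult)
  then obtain t where t: "a1 - b1 = x * t" by (rule dvdE)
  have "x * ((x - y) * t) = x * ((scalar l - 1) * b1)" using eq3 unfolding t by (simp only: ac_simps)
  then have eq4: "(x - y) * t = (scalar l - 1) * b1" by (rule mult_left_cancel[OF variable_neq_0, THEN iffD1])
  let ?C = "scalar (1 / (l - 1))"
  have C: "?C * (scalar l - 1) = 1"
  proof -
    have "?C * (scalar l - 1) = scalar (1 / (l - 1) * (l - 1))"
      by (simp add: right_diff_distrib mult_single single_diff flip: single_one)
    then show ?thesis using l by simp
  qed
  have "b1 = (?C * (scalar l - 1)) * b1" by (simp only: C mult_1)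
  also have "\<dots> = ?C * ((scalar l - 1) * b1)" by (simp only: ac_simps)
  also have "\<dots> = (x - y) * (?C * t)" unfolding eq4[symmetric] by (simp only: ac_simps)
  finally have b1': "b1 = (x - y) * (?C * t)" .
  have "(x - y) * a1 = (x - y) * (?m * (?C * t))" using eq2 unfolding b1' by (simp only: ac_simps)
  then have "a1 = ?m * (?C * t)" by (rule mult_left_cancel[OF x_minus_y_neq_0, THEN iffD1])
  then have "a = quadric2 l * (?C * t)" unfolding a1 by (simp only: ac_simps)
  moreover have "b = - quadric1 * (?C * t)"
    using b1 unfolding b1' by (simp add: minus_equation_iff[of b] mult.assoc)
  ultimately show ?thesis by blast
qed

text \<open>
  The first family of syzygies is \<open>y quadric1 = x quadric2\<close>, caused by the common factor \<open>x - y\<close>; the second is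
  \<open>y\<^sup>2 quadric2 = (x - y) y\<^sup>3\<close>. Since \<open>y\<close> does not divide \<open>x - y\<close>, it can be split off repeatedly.
\<close>

lemma syzygies_special:
  fixes a b c :: "'k::field poly3"
  assumes rel: "quadric1 * a + quadric2 1 * b + y ^ 3 * c = 0"
  shows "\<exists>s t. a = y * s \<and> b = y ^ 2 * t - x * s \<and> c = - (x - y) * t"
proof -
  have "(x - y) * (x * a + y * b) = y * (y ^ 2 * - c)"
    using rel by (simp add: algebra_simps eq_neg_iff_add_eq_0 power2_eq_square power3_eq_cube)
  then have "y dvd (x - y) * (x * a + y * b)" by (metis dvd_triv_left)
  then have "y dvd x * a + y * b" by (simp only: y_dvd_linear_mult)
  then have "y dvd x * a" by (simp add: dvd_add_left_iff)
  then obtain s where s: "a = y * s" by (auto simp: y_dvd_x_mult elim: dvdE)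
  have "y * ((x - y) * (x * s + b)) = y * (y * (y * - c))"
    using \<open>(x - y) * (x * a + y * b) = y * (y ^ 2 * - c)\<close> unfolding s
    by (simp add: algebra_simps power2_eq_square)
  then have eq1: "(x - y) * (x * s + b) = y * (y * - c)" by (rule mult_left_cancel[OF variable_neq_0, THEN iffD1])
  then have "y dvd (x - y) * (x * s + b)" by (metis dvd_triv_left)
  then have "y dvd x * s + b" by (simp only: y_dvd_linear_mult)
  then obtain e where e: "x * s + b = y * e" by (rule dvdE)
  have "y * ((x - y) * e) = y * (y * - c)" using eq1 unfolding e by (simp only: ac_simps)
  then have eq2: "(x - y) * e = y * - c" by (rule mult_left_cancel[OF variable_neq_0, THEN iffD1])
  then have "y dvd (x - y) * e" by (metis dvd_triv_left)
  then have "y dvd e" by (simp only: y_dvd_linear_mult)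
  then obtain t where t: "e = y * t" by (rule dvdE)
  have "y * ((x - y) * t) = y * - c" using eq2 unfolding t by (simp only: ac_simps)
  then have "(x - y) * t = - c" by (rule mult_left_cancel[OF variable_neq_0, THEN iffD1])
  then have "- ((x - y) * t) = c" by (simp only: minus_minus)
  then have "c = - (x - y) * t" by (simp only: mult_minus_left)
  moreover have "b = y ^ 2 * t - x * s"
    using e unfolding t by (simp add: power2_eq_square algebra_simps eq_diff_eq)
  ultimately show ?thesis using s by blast
qed

section \<open>Graded Betti numbers\<close>

lemma mat_mult_vec_conv:
  "w \<in> carrier_vec nc \<Longrightarrow> mat nr nc F *\<^sub>v w = vec nr (\<lambda>i. \<Sum>j<nc. F (i, j) * w $ j)"
  by (intro eq_vecI) (auto simp: scalar_prod_def atLeast0LessThan)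

lemma mat_image_conv:
  "mat_image (mat nr nc F) = range (\<lambda>w. vec nr (\<lambda>i. \<Sum>j<nc. F (i, j) * w j))"
proof
  show "mat_image (mat nr nc F) \<subseteq> range (\<lambda>w. vec nr (\<lambda>i. \<Sum>j<nc. F (i, j) * w j))"
    by (auto simp: mat_image_def mat_mult_vec_conv)
  show "range (\<lambda>w. vec nr (\<lambda>i. \<Sum>j<nc. F (i, j) * w j)) \<subseteq> mat_image (mat nr nc F)"
  proof clarify
    fix w :: "nat \<Rightarrow> 'a"
    have "vec nr (\<lambda>i. \<Sum>j<nc. F (i, j) * w j) = mat nr nc F *\<^sub>v vec nc w"
      by (subst mat_mult_vec_conv) (auto intro!: eq_vecI)
    then show "vec nr (\<lambda>i. \<Sum>j<nc. F (i, j) * w j) \<in> mat_image (mat nr nc F)"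
      unfolding mat_image_def by auto
  qed
qed

lemma mat_kernel_conv:
  "mat_kernel (mat nr nc F) = {v \<in> carrier_vec nc. \<forall>i<nr. (\<Sum>j<nc. F (i, j) * v $ j) = 0}"
proof -
  have "mat nr nc F *\<^sub>v v = 0\<^sub>v nr \<longleftrightarrow> (\<forall>i<nr. (\<Sum>j<nc. F (i, j) * v $ j) = 0)"
    if "v \<in> carrier_vec nc" for v
    by (subst mat_mult_vec_conv[OF that]) (auto simp: vec_eq_iff)
  then show ?thesis by (auto simp: mat_kernel_def)
qed

text \<open>
  A list of generators \<open>gs\<close> and a matrix \<open>A\<close>, given by its rows, whose columns freely generate the syzygies, form a
  resolution \<open>0 \<rightarrow> F\<^sub>2 \<rightarrow> F\<^sub>1 \<rightarrow> S\<close>. From the third module on, all free modules are zero and the matrices are empty.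
\<close>

lemma minimal_resolution_length_two:
  fixes gs :: "'k::field poly3 list" and A :: "'k poly3 list list" and d1 d2 :: "int list"
  defines "n \<equiv> length gs" and "m \<equiv> length d2"
  assumes "length d1 = n"
    and gs: "\<And>b. b < n \<Longrightarrow> gs ! b \<in> irrelevant_ideal"
    and A: "\<And>b c. b < n \<Longrightarrow> c < m \<Longrightarrow> A ! b ! c \<in> irrelevant_ideal"
    and deg1: "\<And>b u. b < n \<Longrightarrow> u \<in> Poly_Mapping.keys (gs ! b) \<Longrightarrow> int (mdeg u) = d1 ! b"
    and deg2: "\<And>b c u. b < n \<Longrightarrow> c < m \<Longrightarrow> u \<in> Poly_Mapping.keys (A ! b ! c) \<Longrightarrow>
      d1 ! b + int (mdeg u) = d2 ! c"
    and ker1: "\<And>w. (\<Sum>b<n. gs ! b * w b) = 0 \<longleftrightarrow> (\<exists>t. \<forall>b<n. w b = (\<Sum>c<m. A ! b ! c * t c))"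
    and ker2: "\<And>t. (\<forall>b<n. (\<Sum>c<m. A ! b ! c * t c) = 0) \<Longrightarrow> \<forall>c<m. t c = 0"
  shows "\<exists>degs e D. minimal_graded_free_resolution (combinations gs) degs e D"
proof -
  define degs where "degs i = (if i = 0 then [0] else if i = 1 then d1 else if i = 2 then d2 else [])" for i :: nat
  define D where "D i = (if i = 0 then mat 1 n (\<lambda>(_, b). gs ! b) else if i = 1 then mat n m (\<lambda>(b, c). A ! b ! c)
    else if i = 2 then mat m 0 (\<lambda>_. 0) else mat 0 0 (\<lambda>_. 0))" for i :: nat
  define e :: "'k poly3 vec" where "e = vec 1 (\<lambda>_. 1)"
  have e: "e \<bullet> v = v $ 0" if "v \<in> carrier_vec 1" for v
    using that by (simp add: e_def scalar_prod_def)
  have "f - e \<bullet> vec 1 (\<lambda>_. f) \<in> combinations gs" for f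
    using ideal_zero[OF is_ideal_combinations[of gs]] by (simp add: e)
  then have surj: "\<exists>v\<in>carrier_vec 1. f - e \<bullet> v \<in> combinations gs" for f by (metis vec_carrier)
  have "{v \<in> carrier_vec 1. e \<bullet> v \<in> combinations gs} = mat_image (D 0)"
    by (auto simp: D_def mat_image_conv e combinations_def image_iff n_def vec_eq_iff)
  moreover have "graded_map (degs i) (degs (Suc i)) (D i)" for i
  proof -
    consider "i = 0" | "i = 1" | "i = 2" | "i > 2" by linarith
    then show ?thesis
      by cases (use deg1 deg2 \<open>length d1 = n\<close> in \<open>auto simp: graded_map_def degs_def D_def m_def\<close>)
  qed
  moreover have "mat_kernel (D i) = mat_image (D (Suc i))" for i
  proof -
    consider "i = 0" | "i = 1" | "i = 2" | "i > 2" by linarith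
    then show ?thesis
    proof cases
      case 1
      show ?thesis
        by (auto simp: 1 D_def mat_kernel_conv mat_image_conv ker1 vec_eq_iff image_iff)
    next
      case 2
      have "v = 0\<^sub>v m"
        if v: "v \<in> carrier_vec m" and "\<forall>b<n. (\<Sum>c<m. A ! b ! c * v $ c) = 0" for v
        using ker2[OF that(2)] v by (intro eq_vecI) auto
      then have "mat_kernel (D i) = {0\<^sub>v m}"
        by (auto simp: 2 D_def mat_kernel_conv)
      moreover have "mat_image (D (Suc i)) = {0\<^sub>v m}"
        by (auto simp: 2 D_def mat_image_conv zero_vec_def)
      ultimately show ?thesis by simp
    next
      case 3
      show ?thesis by (auto simp: 3 D_def mat_kernel_conv mat_image_conv)
    next
      case 4
      then show ?thesis by (auto simp: D_def mat_kernel_conv mat_image_conv)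
    qed
  qed
  moreover have "D i $$ (a, b) \<in> irrelevant_ideal" if "a < length (degs i)" "b < length (degs (Suc i))" for i a b
    using that gs A \<open>length d1 = n\<close> by (auto simp: degs_def D_def m_def split: if_splits)
  ultimately have "minimal_graded_free_resolution (combinations gs) degs e D"
    using surj
    by (auto simp: minimal_graded_free_resolution_def graded_free_resolution_def degs_def e_def mdeg_def)
  then show ?thesis by blast
qed

text \<open>
  The information on the first differential of a minimal resolution that determines the first Betti numbers:
  no relation between the generators involves a unit.
\<close>

definition minimal_generators :: "'k::field poly3 set \<Rightarrow> int list \<Rightarrow> 'k poly3 list \<Rightarrow> bool" where
  "minimal_generators I ds gs \<longleftrightarrow>
     length ds = length gs \<and> I = combinations gs \<and>
     (\<forall>b<length gs. \<forall>u\<in>Poly_Mapping.keys (gs ! b). int (mdeg u) = ds ! b) \<and>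
     (\<forall>w. (\<Sum>b<length gs. gs ! b * w b) = 0 \<longrightarrow> (\<forall>b<length gs. coef (w b) 0 = 0))"

text \<open>
  Minimality makes the augmentation injective modulo the irrelevant ideal. Since \<open>1\<close> has to be reached, some basis
  vector is mapped to a nonzero constant; the image of any other basis vector is a multiple of this constant,
  and the resulting relation has the coefficient \<open>- 1\<close>.
\<close>

lemma minimal_resolution_degs_0:
  assumes res: "minimal_graded_free_resolution I degs e D"
    and I: "is_ideal I" "\<And>p. p \<in> I \<Longrightarrow> coef p 0 = 0"
  obtains c where "length (degs 0) = 1" "degs 0 ! 0 = 0" "c \<noteq> 0" "e $ 0 = scalar c"
proof -
  define n where "n = length (degs 0)"
  from res have e: "e \<in> carrier_vec n"
    and edeg: "\<And>a u. a < n \<Longrightarrow> u \<in> Poly_Mapping.keys (e $ a) \<Longrightarrow> int (mdeg u) = degs 0 ! a"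
    and surj: "\<And>f. \<exists>v\<in>carrier_vec n. f - e \<bullet> v \<in> I"
    and ker: "{v \<in> carrier_vec n. e \<bullet> v \<in> I} = mat_image (D 0)"
    and D0: "D 0 \<in> carrier_mat n (length (degs 1))"
    and min: "\<And>a b. a < n \<Longrightarrow> b < length (degs 1) \<Longrightarrow> D 0 $$ (a, b) \<in> irrelevant_ideal"
    by (auto simp: minimal_graded_free_resolution_def graded_free_resolution_def n_def graded_map_def)
  have ev: "e \<bullet> v = (\<Sum>a<n. e $ a * v $ a)" if "v \<in> carrier_vec n" for v
    using that by (simp add: scalar_prod_def atLeast0LessThan)
  have ker0: "coef (v $ a) 0 = 0" if v: "v \<in> carrier_vec n" "e \<bullet> v \<in> I" and a: "a < n" for v a
  proof -
    have "v \<in> mat_image (D 0)" using v ker by auto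
    then obtain w where w: "w \<in> carrier_vec (length (degs 1))" "v = D 0 *\<^sub>v w"
      using D0 by (auto simp: mat_image_def)
    have "v $ a = (\<Sum>b<length (degs 1). D 0 $$ (a, b) * w $ b)"
      using w D0 a by (simp add: scalar_prod_def atLeast0LessThan)
    then show ?thesis
      using min[OF a] by (simp add: lookup_sum coef_0_mult irrelevant_ideal_coef_0)
  qed
  obtain v where v: "v \<in> carrier_vec n" "1 - e \<bullet> v \<in> I" using surj by blast
  have "coef (e \<bullet> v) 0 = 1" using I(2)[OF v(2)] by (simp add: lookup_minus)
  then have "(\<Sum>a<n. coef (e $ a) 0 * coef (v $ a) 0) \<noteq> 0"
    using v(1) by (simp add: ev lookup_sum coef_0_mult)
  then obtain a where a: "a < n" "coef (e $ a) 0 \<noteq> 0"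
    by (metis (no_types, lifting) lessThan_iff mult_zero_left sum.neutral)
  let ?c = "coef (e $ a) 0"
  have dega: "degs 0 ! a = 0" using edeg[OF a(1), of 0] a(2) by (simp add: in_keys_iff mdeg_def)
  have ea: "e $ a = scalar ?c"
  proof (rule poly_mapping_eqI)
    fix u
    have "coef (e $ a) u = 0" if "u \<noteq> 0"
    proof (rule ccontr)
      assume "coef (e $ a) u \<noteq> 0"
      then have "mdeg u = 0" using edeg[OF a(1), of u] dega by (simp add: in_keys_iff)
      then show False using that by (simp add: mdeg_def monomial_eq_iff)
    qed
    then show "coef (e $ a) u = coef (scalar ?c) u" by (simp add: lookup_single when_def)
  qed
  have "b = a" if b: "b < n" for b
  proof (rule ccontr)
    assume "b \<noteq> a"
    let ?v = "vec n (\<lambda>i. if i = a then scalar (1 / ?c) * e $ b else if i = b then - 1 else 0)"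
    have "e \<bullet> ?v = (\<Sum>i<n. (if i = a then e $ a * (scalar (1 / ?c) * e $ b) else 0) +
        (if i = b then - e $ b else 0))"
      unfolding ev[OF vec_carrier] using \<open>b \<noteq> a\<close> by (intro sum.cong) auto
    also have "\<dots> = e $ a * (scalar (1 / ?c) * e $ b) - e $ b"
      using a b by (simp add: sum.distrib sum.delta)
    also have "\<dots> = (e $ a * scalar (1 / ?c)) * e $ b - e $ b" by (simp only: mult.assoc)
    also have "e $ a * scalar (1 / ?c) = 1" using a(2) by (subst ea) (simp add: mult_single)
    finally have "e \<bullet> ?v = 0" by simp
    then have "e \<bullet> ?v \<in> I" using ideal_zero[OF I(1)] by simp
    from ker0[OF vec_carrier this b] show False using b \<open>b \<noteq> a\<close> by simp
  qed
  then have "n = 1" using a(1) by (metis less_one linorder_neqE_nat not_less_zero zero_neq_one)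
  then show ?thesis using that a ea dega by (auto simp: n_def)
qed

text \<open>
  The free module in homological degree zero is \<open>S\<close> itself and its basis vector is mapped to a unit, so the image of the
  first differential is the ideal; exactness and minimality at the next step concern the relations.
\<close>

lemma minimal_resolution_generators:
  assumes res: "minimal_graded_free_resolution I degs e D"
    and I: "is_ideal I" "\<And>p. p \<in> I \<Longrightarrow> coef p 0 = 0"
  shows "\<exists>gs. minimal_generators I (degs 1) gs"
proof -
  obtain c where c: "length (degs 0) = 1" "degs 0 ! 0 = 0" "c \<noteq> 0" "e $ 0 = scalar c"
    using minimal_resolution_degs_0[OF assms] .
  define m where "m = length (degs 1)"
  have map: "graded_map (degs i) (degs (Suc i)) (D i)"
    and ker: "mat_kernel (D i) = mat_image (D (Suc i))"
    and min: "\<And>a b. a < length (degs i) \<Longrightarrow> b < length (degs (Suc i)) \<Longrightarrow> D i $$ (a, b) \<in> irrelevant_ideal"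
    for i using res by (simp_all add: minimal_graded_free_resolution_def graded_free_resolution_def)
  have e: "e \<in> carrier_vec 1" and ker_e: "{v \<in> carrier_vec 1. e \<bullet> v \<in> I} = mat_image (D 0)"
    using res c by (simp_all add: minimal_graded_free_resolution_def graded_free_resolution_def)
  have D0: "D 0 \<in> carrier_mat 1 m"
    and deg: "\<And>b u. b < m \<Longrightarrow> u \<in> Poly_Mapping.keys (D 0 $$ (0, b)) \<Longrightarrow> int (mdeg u) = degs 1 ! b"
    using map[of 0] c by (simp_all add: graded_map_def m_def)
  have D1: "D 1 \<in> carrier_mat m (length (degs 2))"
    using map[of 1] by (simp add: graded_map_def m_def numeral_2_eq_2)
  have ker1: "mat_kernel (D 0) = mat_image (D 1)" using ker[of 0] by simp
  have min1: "D 1 $$ (a, b) \<in> irrelevant_ideal" if "a < m" "b < length (degs 2)" for a b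
    using min[of a 1 b] that by (simp add: m_def numeral_2_eq_2)
  define gs where "gs = map (\<lambda>b. D 0 $$ (0, b)) [0..<m]"
  have len: "length gs = m" and nth: "\<And>b. b < m \<Longrightarrow> gs ! b = D 0 $$ (0, b)" by (simp_all add: gs_def)
  have D0_eq: "D 0 = mat 1 m (\<lambda>(_, b). gs ! b)"
    using D0 by (intro eq_matI) (auto simp: nth)
  have ev: "e \<bullet> v = scalar c * v $ 0" if "v \<in> carrier_vec 1" for v
    using that c by (simp add: scalar_prod_def)
  have "p \<in> I \<longleftrightarrow> p \<in> combinations gs" for p
  proof -
    have "p = scalar (1 / c) * (scalar c * p)"
      using c(3) by (simp add: mult_single flip: mult.assoc)
    then have "p \<in> I \<longleftrightarrow> scalar c * p \<in> I" using ideal_mult[OF I(1)] by metis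
    also have "\<dots> \<longleftrightarrow> vec 1 (\<lambda>_. p) \<in> mat_image (D 0)" by (simp add: ev flip: ker_e)
    also have "\<dots> \<longleftrightarrow> p \<in> combinations gs"
      by (auto simp: D0_eq mat_image_conv combinations_def len vec_eq_iff image_iff)
    finally show ?thesis .
  qed
  then have "I = combinations gs" by blast
  moreover have "coef (w b) 0 = 0" if w: "(\<Sum>b<m. gs ! b * w b) = 0" and b: "b < m" for w b
  proof -
    have "vec m w \<in> mat_kernel (D 0)" using w by (simp add: D0_eq mat_kernel_conv)
    then obtain t where t: "t \<in> carrier_vec (length (degs 2))" "vec m w = D 1 *\<^sub>v t"
      unfolding ker1 using D1 by (auto simp: mat_image_def)
    have "w b = vec m w $ b" using b by simp
    also have "\<dots> = (D 1 *\<^sub>v t) $ b" by (simp only: t(2))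
    also have "\<dots> = (\<Sum>c<length (degs 2). D 1 $$ (b, c) * t $ c)"
      using t D1 b by (simp add: scalar_prod_def atLeast0LessThan)
    finally show ?thesis
      using min1[OF b] by (simp add: lookup_sum coef_0_mult irrelevant_ideal_coef_0)
  qed
  ultimately have "minimal_generators I (degs 1) gs"
    using deg nth m_def by (auto simp: minimal_generators_def len)
  then show ?thesis by blast
qed

lemma betti_1_eq:
  assumes I: "is_ideal I" "\<And>p. p \<in> I \<Longrightarrow> coef p 0 = 0"
    and ex: "\<exists>degs e D. minimal_graded_free_resolution I degs e D"
    and count: "\<And>ds gs. minimal_generators I ds gs \<Longrightarrow> count_list ds j = n"
  shows "betti I 1 j = n"
  unfolding betti_def
proof (rule the_equality)
  have *: "count_list (degs 1) j = n" if "minimal_graded_free_resolution I degs e D" for degs e D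
    using minimal_resolution_generators[OF that I] count by blast
  then show "\<exists>degs e D. minimal_graded_free_resolution I degs e D \<and> n = count_list (degs 1) j"
    using ex by metis
  show "m = n" if "\<exists>degs e D. minimal_graded_free_resolution I degs e D \<and> m = count_list (degs 1) j" for m
    using that * by auto
qed

lemma minimal_generators_relation:
  assumes "minimal_generators I ds gs" "(\<Sum>b<length gs. gs ! b * w b) = 0" "b < length gs"
  shows "coef (w b) 0 = 0"
  using assms by (simp add: minimal_generators_def)

definition irrelevant_multiples :: "'k::field poly3 set \<Rightarrow> 'k poly3 set" where
  "irrelevant_multiples I = ideal_gen {a * p |a p. coef a 0 = 0 \<and> p \<in> I}"

lemma irrelevant_multiplesI:
  "p \<in> I \<Longrightarrow> coef a 0 = 0 \<Longrightarrow> p * a \<in> irrelevant_multiples I"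
  unfolding irrelevant_multiples_def by (rule hull_inc) (auto simp: mult.commute)

text \<open>
  An element of the irrelevant multiples is a combination of the generators with coefficients in the irrelevant ideal.
  The difference of two expressions of the same element is a relation between the generators.
\<close>

lemma nakayama:
  assumes gs: "minimal_generators I ds gs"
    and c: "(\<Sum>b<length gs. gs ! b * c b) \<in> irrelevant_multiples I" and b: "b < length gs"
  shows "coef (c b) 0 = 0"
proof -
  let ?N = "{p. \<exists>w. (\<forall>b. coef (w b) 0 = 0) \<and> p = (\<Sum>b<length gs. gs ! b * w b)}"
  have "is_ideal ?N"
    unfolding is_ideal_def
  proof (intro conjI ballI allI)
    show "0 \<in> ?N" by (auto intro!: exI[of _ "\<lambda>_. 0"])
    show "p + q \<in> ?N" if pq: "p \<in> ?N" "q \<in> ?N" for p q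
    proof -
      obtain v w where "\<forall>b. coef (v b) 0 = 0" "p = (\<Sum>b<length gs. gs ! b * v b)"
        "\<forall>b. coef (w b) 0 = 0" "q = (\<Sum>b<length gs. gs ! b * w b)" using pq by blast
      then show ?thesis
        by (auto intro!: exI[of _ "\<lambda>b. v b + w b"] simp: lookup_add distrib_left sum.distrib)
    qed
    show "r * p \<in> ?N" if p: "p \<in> ?N" for p r
    proof -
      obtain w where "\<forall>b. coef (w b) 0 = 0" "p = (\<Sum>b<length gs. gs ! b * w b)" using p by blast
      then show ?thesis
        by (auto intro!: exI[of _ "\<lambda>b. r * w b"] simp: coef_0_mult sum_distrib_left mult.left_commute)
    qed
  qed
  moreover have "a * p \<in> ?N" if a: "coef a 0 = 0" and p: "p \<in> I" for a p
  proof -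
    obtain w where "p = (\<Sum>b<length gs. gs ! b * w b)"
      using gs p by (auto simp: minimal_generators_def combinations_def)
    then show ?thesis using a
      by (auto intro!: exI[of _ "\<lambda>b. a * w b"] simp: coef_0_mult sum_distrib_left mult.left_commute)
  qed
  ultimately have "irrelevant_multiples I \<subseteq> ?N"
    unfolding irrelevant_multiples_def by (intro hull_minimal) auto
  then obtain w where w: "\<forall>b. coef (w b) 0 = 0"
    "(\<Sum>b<length gs. gs ! b * c b) = (\<Sum>b<length gs. gs ! b * w b)" using c by auto
  have "(\<Sum>b<length gs. gs ! b * (c b - w b)) = 0"
    by (simp add: right_diff_distrib sum_subtractf w(2))
  then have "coef (c b - w b) 0 = 0"
    by (rule minimal_generators_relation[OF gs _ b])
  then show ?thesis using w(1) by (simp add: lookup_minus)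
qed

lemma minimal_generator_not_irrelevant_multiple:
  assumes gs: "minimal_generators I ds gs" and b: "b < length gs"
  shows "gs ! b \<notin> irrelevant_multiples I"
proof
  assume "gs ! b \<in> irrelevant_multiples I"
  also have "gs ! b = (\<Sum>i<length gs. gs ! i * (if i = b then 1 else 0))"
    using b by (simp add: if_distrib sum.delta cong: if_cong)
  finally show False using nakayama[OF gs _ b, of "\<lambda>i. if i = b then 1 else 0"] by simp
qed

section \<open>The Betti number in homological degree one and internal degree three\<close>

lemma quad_plane_coef_0: "p \<in> quad_ideal P \<Longrightarrow> coef p 0 = 0"
  by (simp add: quad_ideal_def flip: mon_0)

text \<open>
  An element of degree three has no quadratic terms, so the constant terms of \<open>a\<close> and \<open>b\<close> vanish: they are,
  up to sign, the coefficients of \<open>x\<^sup>2\<close> and \<open>y\<^sup>2\<close>.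
\<close>

lemma cubic_irrelevant_multiple:
  fixes l :: "'k::field"
  assumes p: "p = quadric1 * a + quadric2 l * b + y ^ 3 * c" and hom: "homogeneous 3 p"
    and c: "coef c 0 = 0"
  shows "p \<in> irrelevant_multiples (quad_ideal (plane l))"
proof -
  have conv: "p = Poly_Mapping.single (mon 2 0 0) 1 * a - Poly_Mapping.single (mon 1 1 0) 1 * a +
    (Poly_Mapping.single (mon 1 1 0) l * b - Poly_Mapping.single (mon 0 2 0) 1 * b) +
    Poly_Mapping.single (mon 0 3 0) 1 * c"
    unfolding p quadrics_conv cube_conv by (simp add: left_diff_distrib)
  have "coef p (mon 2 0 0) = 0" "coef p (mon 0 2 0) = 0"
    using hom by (auto simp: homogeneous_iff_coef)
  then have "coef a (mon 0 0 0) = 0" "coef b (mon 0 0 0) = 0"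
    unfolding conv by (simp_all add: lookup_add lookup_minus coef_term_mult)
  then have "coef a 0 = 0" "coef b 0 = 0" by (simp_all only: mon_0)
  then show ?thesis unfolding p using c
    unfolding irrelevant_multiples_def
    by (intro ideal_add is_ideal_ideal_gen irrelevant_multiplesI[unfolded irrelevant_multiples_def] generators_in_quad_plane)
qed

lemma homogeneous_entries:
  "homogeneous 1 (x :: 'k::field poly3)" "homogeneous 1 (y :: 'k poly3)" "homogeneous 1 (x - y :: 'k poly3)"
  "homogeneous 2 (quadric1 :: 'k poly3)" "homogeneous 2 (quadric2 l :: 'k poly3)"
  "homogeneous 2 (y ^ 2 :: 'k poly3)" "homogeneous 3 (y ^ 3 :: 'k poly3)"
  unfolding quadrics_conv cube_conv
  by (auto simp: variable_conv_mon power2_eq_square mult_single homogeneous_iff_coef lookup_minus lookup_single when_def)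

lemma homogeneous_uminus: "homogeneous d p \<Longrightarrow> homogeneous d (- p)" for p :: "'k::field poly3"
  by (simp add: homogeneous_iff_coef)

lemma irrelevant_entries:
  fixes p :: "'k::field poly3"
  shows "variable i * p \<in> irrelevant_ideal" "x - y \<in> (irrelevant_ideal :: 'k poly3 set)"
    "n > 0 \<Longrightarrow> variable i ^ n \<in> (irrelevant_ideal :: 'k poly3 set)"
    "p \<in> irrelevant_ideal \<Longrightarrow> - p \<in> irrelevant_ideal"
proof -
  note irr = is_ideal_irrelevant[where 'a = 'k]
  show *: "variable i * p \<in> irrelevant_ideal" for p :: "'k poly3"
    using ideal_mult[OF irr variable_in_irrelevant] by (simp add: mult.commute)
  show "x - y \<in> (irrelevant_ideal :: 'k poly3 set)"
    by (intro ideal_diff irr variable_in_irrelevant)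
  show "n > 0 \<Longrightarrow> variable i ^ n \<in> (irrelevant_ideal :: 'k poly3 set)"
    using * by (cases n) simp_all
  show "p \<in> irrelevant_ideal \<Longrightarrow> - p \<in> irrelevant_ideal"
    using ideal_mult[OF irr, of p "- 1"] by simp
qed

text \<open>
  Every cubic form in the ideal is a combination of the two quadrics, hence an irrelevant multiple, and no minimal
  generator can be one. The resolution is the Koszul complex of the two quadrics.
\<close>

lemma betti_generic:
  fixes l :: "'k::field"
  assumes l: "l \<noteq> 0" "l \<noteq> 1"
  shows "betti (quad_ideal (plane l)) 1 3 = 0"
proof (rule betti_1_eq[OF is_ideal_quad_plane quad_plane_coef_0])
  fix ds gs
  assume gs: "minimal_generators (quad_ideal (plane l)) ds gs"
  have "ds ! b \<noteq> 3" if b: "b < length gs" for b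
  proof
    assume "ds ! b = 3"
    then have hom: "homogeneous 3 (gs ! b)"
      using gs b by (auto simp: minimal_generators_def homogeneous_def)
    have "gs ! b \<in> quad_ideal (plane l)"
      using gs b set_subset_combinations[of gs] nth_mem unfolding minimal_generators_def by blast
    then obtain w where "gs ! b = (\<Sum>i<length [quadric1, quadric2 l]. [quadric1, quadric2 l] ! i * w i)"
      unfolding quad_plane_eq_generic[OF l] combinations_def by blast
    then have "gs ! b = quadric1 * w 0 + quadric2 l * w 1 + y ^ 3 * 0" by simp
    from cubic_irrelevant_multiple[OF this hom]
    have "gs ! b \<in> irrelevant_multiples (quad_ideal (plane l))" by simp
    then show False using minimal_generator_not_irrelevant_multiple[OF gs b] by simp
  qed
  then show "count_list ds 3 = 0"
    using gs by (auto simp: count_list_0_iff in_set_conv_nth minimal_generators_def)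
next
  let ?gs = "[quadric1, quadric2 l]" and ?A = "[[quadric2 l], [- quadric1]]"
  let ?d1 = "[2, 2] :: int list" and ?d2 = "[4] :: int list"
  have "\<exists>degs e D. minimal_graded_free_resolution (combinations ?gs) degs e D"
  proof (rule minimal_resolution_length_two[where A = ?A and ?d1.0 = ?d1 and ?d2.0 = ?d2])
    show "length ?d1 = length ?gs" by simp
    show "?gs ! b \<in> irrelevant_ideal" if "b < length ?gs" for b
      using that by (auto simp: less_Suc_eq irrelevant_entries)
    show "?A ! b ! c \<in> irrelevant_ideal" if "b < length ?gs" "c < length ?d2" for b c
      using that by (auto simp: less_Suc_eq irrelevant_entries)
    show "int (mdeg u) = ?d1 ! b" if "b < length ?gs" "u \<in> Poly_Mapping.keys (?gs ! b)" for b u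
      using that homogeneous_entries(4)[where 'k = 'k] homogeneous_entries(5)[of l]
      unfolding homogeneous_def by (auto simp: less_Suc_eq)
    show "?d1 ! b + int (mdeg u) = ?d2 ! c"
      if "b < length ?gs" "c < length ?d2" "u \<in> Poly_Mapping.keys (?A ! b ! c)" for b c u
      using that homogeneous_entries(5)[of l] homogeneous_uminus[OF homogeneous_entries(4)[where 'k = 'k]]
      unfolding homogeneous_def by (auto simp: less_Suc_eq)
  next
    fix w
    have "(\<Sum>b<length ?gs. ?gs ! b * w b) = quadric1 * w 0 + quadric2 l * w 1" by simp
    moreover have "(\<forall>b<length ?gs. w b = (\<Sum>c<length ?d2. ?A ! b ! c * t c)) \<longleftrightarrow>
      w 0 = quadric2 l * t 0 \<and> w 1 = - quadric1 * t 0" for t :: "nat \<Rightarrow> 'k poly3"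
      by (auto simp: less_Suc_eq)
    moreover have "quadric1 * w 0 + quadric2 l * w 1 = 0 \<longleftrightarrow>
      (\<exists>t :: nat \<Rightarrow> 'k poly3. w 0 = quadric2 l * t 0 \<and> w 1 = - quadric1 * t 0)"
    proof
      assume "quadric1 * w 0 + quadric2 l * w 1 = 0"
      then obtain t where "w 0 = quadric2 l * t \<and> w 1 = - quadric1 * t"
        using syzygies_generic[OF l(2)] by blast
      then show "\<exists>t :: nat \<Rightarrow> 'k poly3. w 0 = quadric2 l * t 0 \<and> w 1 = - quadric1 * t 0"
        by (intro exI[of _ "\<lambda>_. t"])
    next
      assume "\<exists>t :: nat \<Rightarrow> 'k poly3. w 0 = quadric2 l * t 0 \<and> w 1 = - quadric1 * t 0"
      then obtain t :: "nat \<Rightarrow> 'k poly3" where t: "w 0 = quadric2 l * t 0" "w 1 = - quadric1 * t 0"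
        by blast
      show "quadric1 * w 0 + quadric2 l * w 1 = 0" unfolding t by (simp add: algebra_simps)
    qed
    ultimately show "(\<Sum>b<length ?gs. ?gs ! b * w b) = 0 \<longleftrightarrow>
      (\<exists>t. \<forall>b<length ?gs. w b = (\<Sum>c<length ?d2. ?A ! b ! c * t c))" by (simp only:)
  next
    fix t :: "nat \<Rightarrow> 'k poly3"
    assume "\<forall>b<length ?gs. (\<Sum>c<length ?d2. ?A ! b ! c * t c) = 0"
    then have "- quadric1 * t 0 = 0" by (auto dest: spec[of _ 1])
    then show "\<forall>c<length ?d2. t c = 0"
      using x_minus_y_neq_0[where 'k = 'k] by (simp add: variable_neq_0)
  qed
  then show "\<exists>degs e D. minimal_graded_free_resolution (quad_ideal (plane l)) degs e D"
    unfolding quad_plane_eq_generic[OF l] by blast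
qed

text \<open>
  The value at the point \<open>(1:1:0)\<close> of the homogeneous component of degree three. All quadrics in the ideal for the
  parameter \<open>1\<close> vanish at this point, so the value detects the cubic generator.
\<close>

definition cubic_value :: "'k::field poly3 \<Rightarrow> 'k" where
  "cubic_value p =
     coef p (mon 3 0 0) + coef p (mon 2 1 0) + coef p (mon 1 2 0) + coef p (mon 0 3 0)"

lemma cubic_value_add: "cubic_value (p + q) = cubic_value p + cubic_value q"
  by (simp add: cubic_value_def lookup_add algebra_simps)

text \<open>
  The functional kills the irrelevant multiples: a linear form times an element of the ideal has the value zero because the
  quadratic part in \<open>x, y\<close> of that element vanishes at \<open>(1:1)\<close>.
\<close>

lemma cubic_value_mult:
  fixes p :: "'k::field poly3"
  assumes p: "p \<in> quad_ideal (plane 1)"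
  shows "cubic_value (p * w) = coef w 0 * cubic_value p"
proof -
  have low: "coef p (mon 0 0 n) = 0" "coef p (mon (Suc 0) 0 n) = 0" "coef p (mon 0 (Suc 0) n) = 0" for n
    using p by (simp_all add: quad_ideal_def)
  have quad: "coef p (mon 2 0 0) + coef p (mon 1 1 0) + coef p (mon 0 2 0) = 0"
    using p by (auto simp: quad_ideal_def plane_def)
  have "cubic_value (w * p) = coef w 0 * cubic_value p"
  proof (induction w rule: poly_induct)
    case zero
    then show ?case by (simp add: cubic_value_def)
  next
    case (add f g)
    then show ?case by (simp add: distrib_right lookup_add cubic_value_add)
  next
    case (monomial a b c r)
    have r: "coef (Poly_Mapping.single (mon a b c) r) 0 = (if a = 0 \<and> b = 0 \<and> c = 0 then r else 0)"
      by (simp add: lookup_single when_def)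
    consider "c > 0" | "a = 0" "b = 0" "c = 0" | "a = 1" "b = 0" "c = 0" | "a = 0" "b = 1" "c = 0"
      | "a + b \<ge> 2" "c = 0" by linarith
    then show ?case
    proof cases
      case 1
      then show ?thesis unfolding r by (simp add: cubic_value_def coef_term_mult)
    next
      case 2
      then show ?thesis unfolding r by (simp add: cubic_value_def coef_term_mult distrib_left)
    next
      case 3
      then have "cubic_value (Poly_Mapping.single (mon a b c) r * p) =
        r * (coef p (mon 2 0 0) + coef p (mon 1 1 0) + coef p (mon 0 2 0))"
        by (simp add: cubic_value_def coef_term_mult distrib_left numeral_3_eq_3 numeral_2_eq_2)
      then show ?thesis using 3 unfolding r quad by simp
    next
      case 4
      then have "cubic_value (Poly_Mapping.single (mon a b c) r * p) =
        r * (coef p (mon 2 0 0) + coef p (mon 1 1 0) + coef p (mon 0 2 0))"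
        by (simp add: cubic_value_def coef_term_mult distrib_left numeral_3_eq_3 numeral_2_eq_2)
      then show ?thesis using 4 unfolding r quad by simp
    next
      case 5
      have "coef (Poly_Mapping.single (mon a b c) r * p) (mon i j 0) = 0" if "i + j = 3" for i j
        using 5 that p unfolding coef_term_mult by (auto simp: quad_ideal_def)
      then show ?thesis using 5 unfolding r by (auto simp: cubic_value_def)
    qed
  qed
  then show ?thesis by (simp add: mult.commute)
qed

lemma cubic_value_sum: "cubic_value (sum f A) = (\<Sum>i\<in>A. cubic_value (f i))"
  by (simp add: cubic_value_def lookup_sum sum.distrib)

lemma cubic_value_generators [simp]:
  "cubic_value (quadric1 :: 'k::field poly3) = 0" "cubic_value (quadric2 l :: 'k poly3) = 0"
  "cubic_value (y ^ 3 :: 'k poly3) = 1"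
  unfolding quadrics_conv cube_conv
  by (simp_all add: cubic_value_def lookup_minus lookup_single when_def)

text \<open>
  The value of a cubic form in the ideal is the constant term of its coefficient at the generator \<open>y\<^sup>3\<close>.
\<close>

lemma cubic_value_0_irrelevant_multiple:
  fixes p :: "'k::field poly3"
  assumes p: "p \<in> quad_ideal (plane 1)" and hom: "homogeneous 3 p" and 0: "cubic_value p = 0"
  shows "p \<in> irrelevant_multiples (quad_ideal (plane 1))"
proof -
  let ?gs = "[quadric1, quadric2 (1 :: 'k), y ^ 3]"
  obtain w where "p = (\<Sum>i<length ?gs. ?gs ! i * w i)"
    using p unfolding quad_plane_eq_special combinations_def by blast
  then have w: "p = quadric1 * w 0 + quadric2 1 * w 1 + y ^ 3 * w 2" by (simp add: numeral_2_eq_2)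
  have "cubic_value p = coef (w 2) 0"
    unfolding w cubic_value_add
    by (simp add: cubic_value_mult[OF generators_in_quad_plane(1)] cubic_value_mult[OF generators_in_quad_plane(2)]
        cubic_value_mult[OF generators_in_quad_plane(3)] del: single_one)
  then show ?thesis using cubic_irrelevant_multiple[OF w hom] 0 by simp
qed

text \<open>
  Modulo irrelevant multiples the cubic forms in the ideal are a line, on which \<open>cubic_value\<close> is a coordinate. At least one
  minimal generator has nonzero value, because \<open>y\<^sup>3\<close> is a combination of them, and two cubic ones would be
  linearly dependent. In the resolution, the syzygies have the degrees three and four.
\<close>

lemma betti_special: "betti (quad_ideal (plane (1 :: 'k::field))) 1 3 = 1"
proof (rule betti_1_eq[OF is_ideal_quad_plane quad_plane_coef_0])
  fix ds gs
  let ?I = "quad_ideal (plane (1 :: 'k))"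
  assume gs: "minimal_generators ?I ds gs"
  note ideal = is_ideal_quad_plane[of "1 :: 'k"]
  have mem: "gs ! b \<in> ?I" if "b < length gs" for b
    using gs that set_subset_combinations[of gs] nth_mem unfolding minimal_generators_def by blast
  have hom: "homogeneous 3 (gs ! b)" if "b < length gs" "ds ! b = 3" for b
    using gs that by (auto simp: minimal_generators_def homogeneous_def)
  have deg: "ds ! b = 3" if b: "b < length gs" and nz: "cubic_value (gs ! b) \<noteq> 0" for b
  proof -
    have "\<exists>u. mdeg u = 3 \<and> coef (gs ! b) u \<noteq> 0"
    proof (rule ccontr)
      assume "\<nexists>u. mdeg u = 3 \<and> coef (gs ! b) u \<noteq> 0"
      then have "coef (gs ! b) u = 0" if "mdeg u = 3" for u using that by blast
      then show False using nz by (simp add: cubic_value_def)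
    qed
    then obtain u where u: "mdeg u = 3" "u \<in> Poly_Mapping.keys (gs ! b)" by (auto simp: in_keys_iff)
    then have "int (mdeg u) = ds ! b" using gs b unfolding minimal_generators_def by blast
    then show ?thesis by (simp add: u)
  qed
  have nz: "cubic_value (gs ! b) \<noteq> 0" if "b < length gs" "ds ! b = 3" for b
    using cubic_value_0_irrelevant_multiple[OF mem hom] minimal_generator_not_irrelevant_multiple[OF gs] that
    by blast
  have "y ^ 3 \<in> combinations gs"
    using gs generators_in_quad_plane(3) unfolding minimal_generators_def by blast
  then obtain w where w: "y ^ 3 = (\<Sum>b<length gs. gs ! b * w b)" by (auto simp: combinations_def)
  have "(\<Sum>b<length gs. coef (w b) 0 * cubic_value (gs ! b)) = cubic_value (y ^ 3 :: 'k poly3)"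
    unfolding w cubic_value_sum by (intro sum.cong refl) (simp add: cubic_value_mult mem)
  then have "(\<Sum>b<length gs. coef (w b) 0 * cubic_value (gs ! b)) \<noteq> 0" by simp
  then obtain b where b: "b < length gs" "cubic_value (gs ! b) \<noteq> 0"
    by (metis (no_types, lifting) lessThan_iff mult_zero_right sum.neutral)
  have unique: "i = b" if i: "i < length gs" "ds ! i = 3" for i
  proof (rule ccontr)
    assume "i \<noteq> b"
    \<comment> \<open>The combination of the two generators in which their values cancel.\<close>
    let ?c = "\<lambda>j. if j = i then scalar (cubic_value (gs ! b)) else if j = b then scalar (- cubic_value (gs ! i)) else 0"
    let ?p = "\<Sum>j<length gs. gs ! j * ?c j"
    have "?p = (\<Sum>j<length gs. (if j = i then gs ! i * scalar (cubic_value (gs ! b)) else 0) +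
        (if j = b then gs ! b * scalar (- cubic_value (gs ! i)) else 0))"
      using \<open>i \<noteq> b\<close> by (intro sum.cong) auto
    also have "\<dots> = gs ! i * scalar (cubic_value (gs ! b)) + gs ! b * scalar (- cubic_value (gs ! i))"
      using i b by (simp add: sum.distrib sum.delta)
    finally have p: "?p = gs ! i * scalar (cubic_value (gs ! b)) + gs ! b * scalar (- cubic_value (gs ! i))" .
    have "?p \<in> ?I"
      unfolding p using ideal_add[OF ideal] ideal_mult[OF ideal] mem i b by (simp add: mult.commute)
    moreover have "homogeneous 3 ?p"
    proof -
      have "homogeneous 3 (g * scalar r)" if "homogeneous 3 g" for g :: "'k poly3" and r
        unfolding homogeneous_iff_coef
      proof (intro allI impI)
        fix u :: monomial
        assume "mdeg u \<noteq> 3"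
        obtain a b c where u: "u = mon a b c" by (rule mon_cases)
        show "coef (g * scalar r) u = 0"
          using that \<open>mdeg u \<noteq> 3\<close> coef_term_mult[of 0 0 0 r g a b c]
          by (simp add: u mon_0 mult.commute homogeneous_iff_coef)
      qed
      then have "homogeneous 3 (gs ! i * scalar (cubic_value (gs ! b)))"
        "homogeneous 3 (gs ! b * scalar (- cubic_value (gs ! i)))"
        using hom i b deg by blast+
      then show ?thesis unfolding p by (simp add: homogeneous_iff_coef lookup_add)
    qed
    moreover have "cubic_value ?p = 0"
      unfolding p cubic_value_add using i b by (simp add: cubic_value_mult mem)
    ultimately have "?p \<in> irrelevant_multiples ?I" by (rule cubic_value_0_irrelevant_multiple)
    from nakayama[OF gs this i(1)] show False using b(2) by simp
  qed
  have "length ds = length gs" using gs unfolding minimal_generators_def by blast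
  then have "i < length ds \<and> 3 = ds ! i \<longleftrightarrow> i = b" for i
    using unique[of i] deg[OF b] b(1) by metis
  then show "count_list ds 3 = 1"
    by (simp add: count_list_eq_length_filter length_filter_conv_card)
next
  let ?gs = "[quadric1, quadric2 (1::'k), y ^ 3]" and ?A = "[[y, 0], [- x, y ^ 2], [0, - (x - y)]] :: 'k poly3 list list"
  let ?d1 = "[2, 2, 3] :: int list" and ?d2 = "[3, 4] :: int list"
  have "\<exists>degs e D. minimal_graded_free_resolution (combinations ?gs) degs e D"
  proof (rule minimal_resolution_length_two[where A = ?A and ?d1.0 = ?d1 and ?d2.0 = ?d2])
    show "length ?d1 = length ?gs" by simp
    show "?gs ! b \<in> irrelevant_ideal" if "b < length ?gs" for b
      using that by (auto simp: less_Suc_eq irrelevant_entries)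
    have entries: "y \<in> (irrelevant_ideal :: 'k poly3 set)" "- x \<in> (irrelevant_ideal :: 'k poly3 set)"
      "y ^ 2 \<in> (irrelevant_ideal :: 'k poly3 set)" "- (x - y) \<in> (irrelevant_ideal :: 'k poly3 set)"
      "0 \<in> (irrelevant_ideal :: 'k poly3 set)"
      by (intro irrelevant_entries(2,3,4) variable_in_irrelevant ideal_zero is_ideal_irrelevant zero_less_numeral)+
    show "?A ! b ! c \<in> irrelevant_ideal" if "b < length ?gs" "c < length ?d2" for b c
    proof -
      have "b = 0 \<or> b = 1 \<or> b = 2" "c = 0 \<or> c = 1" using that by auto
      then show ?thesis using entries by (elim disjE) (simp_all only: nth_Cons_0 nth_Cons_Suc One_nat_def numeral_2_eq_2)
    qed
    show "int (mdeg u) = ?d1 ! b" if "b < length ?gs" "u \<in> Poly_Mapping.keys (?gs ! b)" for b u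
    proof -
      have "b = 0 \<or> b = 1 \<or> b = 2" using that(1) by auto
      then show ?thesis
        using that(2) homogeneous_entries(4,7)[where 'k = 'k] homogeneous_entries(5)[of "1 :: 'k"]
        unfolding homogeneous_def
        by (elim disjE) (simp_all del: single_one)
    qed
    show "?d1 ! b + int (mdeg u) = ?d2 ! c"
      if "b < length ?gs" "c < length ?d2" "u \<in> Poly_Mapping.keys (?A ! b ! c)" for b c u
    proof -
      have "b = 0 \<or> b = 1 \<or> b = 2" "c = 0 \<or> c = 1" using that by auto
      then show ?thesis
        using that(3) homogeneous_entries(2,6)[where 'k = 'k]
          homogeneous_entries(1,3)[where 'k = 'k, THEN homogeneous_uminus]
        unfolding homogeneous_def
        by (elim disjE) simp_all
    qed
  next
    fix w
    have "(\<Sum>b<length ?gs. ?gs ! b * w b) = quadric1 * w 0 + quadric2 1 * w 1 + y ^ 3 * w 2"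
      by (simp add: numeral_2_eq_2)
    moreover have "(\<forall>b<length ?gs. w b = (\<Sum>c<length ?d2. ?A ! b ! c * t c)) \<longleftrightarrow>
      w 0 = y * t 0 \<and> w 1 = y ^ 2 * t 1 - x * t 0 \<and> w 2 = - (x - y) * t 1" for t :: "nat \<Rightarrow> 'k poly3"
      by (auto simp: less_Suc_eq numeral_2_eq_2)
    moreover have "quadric1 * w 0 + quadric2 1 * w 1 + y ^ 3 * w 2 = 0 \<longleftrightarrow>
      (\<exists>t :: nat \<Rightarrow> 'k poly3. w 0 = y * t 0 \<and> w 1 = y ^ 2 * t 1 - x * t 0 \<and> w 2 = - (x - y) * t 1)"
      (is "_ \<longleftrightarrow> (\<exists>t. ?syz t)")
    proof
      assume "quadric1 * w 0 + quadric2 1 * w 1 + y ^ 3 * w 2 = 0"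
      then obtain s t where "w 0 = y * s \<and> w 1 = y ^ 2 * t - x * s \<and> w 2 = - (x - y) * t"
        using syzygies_special by blast
      then show "\<exists>t. ?syz t" by (intro exI[of _ "\<lambda>i. if i = 0 then s else t"]) simp
    next
      assume "\<exists>t. ?syz t"
      then obtain t :: "nat \<Rightarrow> 'k poly3" where t: "w 0 = y * t 0" "w 1 = y ^ 2 * t 1 - x * t 0" "w 2 = - (x - y) * t 1"
        by blast
      show "quadric1 * w 0 + quadric2 1 * w 1 + y ^ 3 * w 2 = 0"
        unfolding t by (simp add: algebra_simps power2_eq_square power3_eq_cube)
    qed
    ultimately show "(\<Sum>b<length ?gs. ?gs ! b * w b) = 0 \<longleftrightarrow>
      (\<exists>t. \<forall>b<length ?gs. w b = (\<Sum>c<length ?d2. ?A ! b ! c * t c))" by (simp only:)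
  next
    fix t :: "nat \<Rightarrow> 'k poly3"
    assume "\<forall>b<length ?gs. (\<Sum>c<length ?d2. ?A ! b ! c * t c) = 0"
    from this[rule_format, of 0] this[rule_format, of 2]
    have "y * t 0 = 0" "(x - y) * t 1 = 0" by auto
    then have "t 0 = 0" "t 1 = 0" using x_minus_y_neq_0[where 'k = 'k] by (simp_all add: variable_neq_0)
    then show "\<forall>c<length ?d2. t c = 0" by (simp add: less_Suc_eq)
  qed
  then show "\<exists>degs e D. minimal_graded_free_resolution (quad_ideal (plane (1::'k))) degs e D"
    unfolding quad_plane_eq_special by blast
qed

theorem theorem1p1:
  fixes \<nu> :: "'k::field \<Rightarrow> tropical"
  assumes "valuation \<nu>"
  shows "\<exists>(J :: tropical poly3 set) (I :: 'k \<Rightarrow> 'k poly3 set).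
    homogeneous_tropical_ideal J \<and>
    (\<forall>l. \<nu> l = Fin 0 \<longrightarrow> homogeneous_ideal (I l)) \<and>
    (\<forall>l m. \<nu> l = Fin 0 \<longrightarrow> \<nu> m = Fin 0 \<longrightarrow> l \<noteq> m \<longrightarrow> I l \<noteq> I m) \<and>
    (\<forall>l. \<nu> l = Fin 0 \<longrightarrow> saturated (I l)) \<and>
    (\<forall>l. \<nu> l = Fin 0 \<longrightarrow> realises \<nu> (I l) J) \<and>
    (\<forall>l. \<nu> l = Fin 0 \<longrightarrow> l \<noteq> 1 \<longrightarrow> (\<exists>i j. betti (I 1) i j \<noteq> betti (I l) i j))"
proof (intro exI conjI allI impI)
  let ?I = "\<lambda>l :: 'k. quad_ideal (plane l)"
  show "homogeneous_tropical_ideal (quad_ideal trop_plane)"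
    by (rule homogeneous_tropical_ideal_quad_ideal)
  show "homogeneous_ideal (?I l)" "saturated (?I l)" for l
    using linear_condition_plane by (rule homogeneous_quad_ideal, rule saturated_quad_ideal)
  show "?I l \<noteq> ?I m" if "l \<noteq> m" for l m
    using that quad_plane_inject by blast
  show "realises \<nu> (?I l) (quad_ideal trop_plane)" if "\<nu> l = Fin 0" for l
    using trop_ideal_quad_plane[OF assms] that by (simp add: realises_def)
  show "betti (?I 1) 1 3 \<noteq> betti (?I l) 1 3" if "\<nu> l = Fin 0" "l \<noteq> 1" for l
  proof -
    have "l \<noteq> 0"
    proof
      assume "l = 0"
      then have "\<nu> l = Infty" using assms by (simp only: valuation_def)
      with that(1) show False by (simp del: tropical_simps)
    qed
    then show ?thesis
      using betti_special[where 'k = 'k] betti_generic[OF _ that(2)] by simp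
  qed
qed

end
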